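(* For every countable structure $\mathcal{A}$ in a countable vocabulary, $SR(\mathcal{A})=SR(\mathcal{T}_{\mathcal{A}})$, where $\mathcal{T}_{\mathcal{A}}$ is the tree of tuples of $\mathcal{A}$.
   Context: Infinitary formulas: $\Sigma^{\mathrm{in}}_0=\Pi^{\mathrm{in}}_0$ are the finitary quantifier-free formulas; for $\alpha\ge1$, a $\Sigma^{\mathrm{in}}_\alpha$ formula is a countable disjunction of formulas $\exists\bar x\,\varphi$ with $\varphi\in\Pi^{\mathrm{in}}_\beta$, $\beta<\alpha$, and $\Pi^{\mathrm{in}}_\alpha$ is dual. The (parameterless) Scott rank $SR(\mathcal{M})$ of a countable structure $\mathcal{M}$ is the least ordinal $\alpha$ such that the automorphism orbit of every finite tuple of $\mathcal{M}$ is definable in $\mathcal{M}$ by a $\Sigma^{\mathrm{in}}_\alpha$ formula without parameters. Tree of tuples: let $T_{\mathcal{A}}$ be the tree of all finite tuples of $\mathcal{A}$ ordered by extension (root the empty tuple), each tuple labeled by a natural number coding its length and its finite atomic diagram. $\mathcal{T}_{\mathcal{A}}$ is obtained by replicating every branch of $T_{\mathcal{A}}$ infinitely many times, so that for every node $\sigma$ with parent $\tau$ there are infinitely many children $\tilde\sigma$ of $\tau$ whose labeled subtrees above them are isomorphic to that above $\sigma$. It is viewed as a structure in the vocabulary of labeled trees (tree order, parent function, labeling $l:T\to\omega$).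
   Formalization: Equality is proved when SR(A) ≥ 1; when SR(A)=0 only SR(T_A) ≤ 1 is claimed, as equality can fail there (e.g. ω with predicates P_i={i}). A length-n tuple's label codes the truth values of the first n atomic formulas in any fixed enumeration. *)

theory Defs
  imports "HOL-Library.Countable_Set" "HOL-Library.Sublist"
begin

subsection \<open>Countable ordinals\<close>

text \<open>The elements of the first uncountable initial ordinal, i.e. exactly the countable ordinals.\<close>

typedef omega1 = "Field (cardSuc natLeq)"
proof -
  have "infinite (Field (cardSuc natLeq))"
    using cardSuc_finite[OF natLeq_Card_order] by (simp add: Field_natLeq)
  then have "Field (cardSuc natLeq) \<noteq> {}" by (metis finite.emptyI)
  then show ?thesis by blast
qed

lemma omega1_Well_order: "Well_order (cardSuc natLeq)"
  using cardSuc_Card_order[OF natLeq_Card_order] by (rule Card_order_wo_rel[unfolded wo_rel_def])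

instantiation omega1 :: wellorder
begin

definition less_eq_omega1 :: "omega1 \<Rightarrow> omega1 \<Rightarrow> bool"
  where "\<alpha> \<le> \<beta> \<longleftrightarrow> (Rep_omega1 \<alpha>, Rep_omega1 \<beta>) \<in> cardSuc natLeq"

definition less_omega1 :: "omega1 \<Rightarrow> omega1 \<Rightarrow> bool"
  where "\<alpha> < \<beta> \<longleftrightarrow> \<alpha> \<le> \<beta> \<and> \<not> \<beta> \<le> (\<alpha>::omega1)"

instance
proof
  let ?r = "cardSuc natLeq"
  have refl: "refl_on (Field ?r) ?r" and trans: "trans ?r" and antisym: "antisym ?r"
    and total: "Total ?r" and wf: "wf (?r - Id)"
    using omega1_Well_order
    by (auto simp: well_order_on_def linear_order_on_def partial_order_on_def preorder_on_def)
  fix x y z :: omega1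
  show "(x < y) = (x \<le> y \<and> \<not> y \<le> x)" by (rule less_omega1_def)
  show xx: "x \<le> x" for x :: omega1
    using refl Rep_omega1 by (auto simp: less_eq_omega1_def refl_on_def)
  show "x \<le> z" if "x \<le> y" "y \<le> z"
    using that trans by (auto simp: less_eq_omega1_def elim: transE)
  show anti: "x = y" if "x \<le> y" "y \<le> x" for x y :: omega1
    using that antisym by (auto simp: less_eq_omega1_def Rep_omega1_inject dest: antisymD)
  show "x \<le> y \<or> y \<le> x"
    using total Rep_omega1[of x] Rep_omega1[of y] xx[of x]
    by (cases "x = y") (auto simp: less_eq_omega1_def total_on_def Rep_omega1_inject)
  show "P a" if step: "\<And>x. (\<And>y. y < x \<Longrightarrow> P y) \<Longrightarrow> P x" for P and a :: omega1
  proof -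
    have "wf (inv_image (?r - Id) Rep_omega1)" using wf by (rule wf_inv_image)
    then show ?thesis
    proof (induction a rule: wf_induct_rule)
      case (less x)
      show ?case
        by (rule step, rule less)
          (auto simp: in_inv_image less_omega1_def less_eq_omega1_def Rep_omega1_inject)
    qed
  qed
qed

end

instantiation omega1 :: "{zero, one}"
begin

definition zero_omega1 :: omega1 where "0 = (LEAST \<alpha>::omega1. True)"
definition one_omega1 :: omega1 where "1 = (LEAST \<alpha>::omega1. 0 < \<alpha>)"

instance ..

end

subsection \<open>Vocabularies and structures\<close>

record ('f, 'r) vocabulary =
  Funs :: "'f set"
  Rels :: "'r set"
  fun_arity :: "'f \<Rightarrow> nat"
  rel_arity :: "'r \<Rightarrow> nat"

definition countable_vocabulary :: "('f, 'r) vocabulary \<Rightarrow> bool"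
  where "countable_vocabulary V \<longleftrightarrow> countable (Funs V) \<and> countable (Rels V)"

text \<open>Constants are function symbols of arity 0. Interpretations are only meaningful on
  argument lists over the universe of the right length.\<close>

record ('a, 'f, 'r) model =
  univ :: "'a set"
  fun_int :: "'f \<Rightarrow> 'a list \<Rightarrow> 'a"
  rel_int :: "'r \<Rightarrow> 'a list \<Rightarrow> bool"

definition tuples :: "('a, 'f, 'r) model \<Rightarrow> nat \<Rightarrow> 'a list set"
  where "tuples M n = {as \<in> lists (univ M). length as = n}"

definition is_model :: "('f, 'r) vocabulary \<Rightarrow> ('a, 'f, 'r) model \<Rightarrow> bool"
  where "is_model V M \<longleftrightarrow> univ M \<noteq> {} \<and>
    (\<forall>f\<in>Funs V. \<forall>as\<in>tuples M (fun_arity V f). fun_int M f as \<in> univ M)"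

definition automorphism :: "('f, 'r) vocabulary \<Rightarrow> ('a, 'f, 'r) model \<Rightarrow> ('a \<Rightarrow> 'a) \<Rightarrow> bool"
  where "automorphism V M g \<longleftrightarrow> bij_betw g (univ M) (univ M) \<and>
    (\<forall>f\<in>Funs V. \<forall>as\<in>tuples M (fun_arity V f). g (fun_int M f as) = fun_int M f (map g as)) \<and>
    (\<forall>r\<in>Rels V. \<forall>as\<in>tuples M (rel_arity V r). rel_int M r (map g as) \<longleftrightarrow> rel_int M r as)"

definition orbit :: "('f, 'r) vocabulary \<Rightarrow> ('a, 'f, 'r) model \<Rightarrow> 'a list \<Rightarrow> 'a list set"
  where "orbit V M as = {map g as | g. automorphism V M g}"

subsection \<open>Finitary quantifier-free formulas\<close>

datatype 'f tm = Var nat | App 'f "'f tm list"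

primrec tm_vars :: "'f tm \<Rightarrow> nat set"
where
  "tm_vars (Var i) = {i}"
| "tm_vars (App f ts) = \<Union> (set (map tm_vars ts))"

primrec tm_in :: "('f, 'r) vocabulary \<Rightarrow> 'f tm \<Rightarrow> bool"
where
  "tm_in V (Var i) \<longleftrightarrow> True"
| "tm_in V (App f ts) \<longleftrightarrow> f \<in> Funs V \<and> length ts = fun_arity V f \<and> list_all (tm_in V) ts"

primrec tm_val :: "('a, 'f, 'r) model \<Rightarrow> (nat \<Rightarrow> 'a) \<Rightarrow> 'f tm \<Rightarrow> 'a"
where
  "tm_val M v (Var i) = v i"
| "tm_val M v (App f ts) = fun_int M f (map (tm_val M v) ts)"

datatype ('f, 'r) atom = Eq "'f tm" "'f tm" | Rel 'r "'f tm list"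

primrec atom_vars :: "('f, 'r) atom \<Rightarrow> nat set"
where
  "atom_vars (Eq s t) = tm_vars s \<union> tm_vars t"
| "atom_vars (Rel r ts) = (\<Union>t\<in>set ts. tm_vars t)"

primrec atom_in :: "('f, 'r) vocabulary \<Rightarrow> ('f, 'r) atom \<Rightarrow> bool"
where
  "atom_in V (Eq s t) \<longleftrightarrow> tm_in V s \<and> tm_in V t"
| "atom_in V (Rel r ts) \<longleftrightarrow> r \<in> Rels V \<and> length ts = rel_arity V r \<and> (\<forall>t\<in>set ts. tm_in V t)"

primrec atom_sat :: "('a, 'f, 'r) model \<Rightarrow> (nat \<Rightarrow> 'a) \<Rightarrow> ('f, 'r) atom \<Rightarrow> bool"
where
  "atom_sat M v (Eq s t) \<longleftrightarrow> tm_val M v s = tm_val M v t"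
| "atom_sat M v (Rel r ts) \<longleftrightarrow> rel_int M r (map (tm_val M v) ts)"

datatype ('f, 'r) qf = Bot | Atom "('f, 'r) atom" | Neg "('f, 'r) qf"
  | And "('f, 'r) qf" "('f, 'r) qf" | Or "('f, 'r) qf" "('f, 'r) qf"

primrec qf_vars :: "('f, 'r) qf \<Rightarrow> nat set"
where
  "qf_vars Bot = {}"
| "qf_vars (Atom a) = atom_vars a"
| "qf_vars (Neg p) = qf_vars p"
| "qf_vars (And p q) = qf_vars p \<union> qf_vars q"
| "qf_vars (Or p q) = qf_vars p \<union> qf_vars q"

primrec qf_in :: "('f, 'r) vocabulary \<Rightarrow> ('f, 'r) qf \<Rightarrow> bool"
where
  "qf_in V Bot \<longleftrightarrow> True"
| "qf_in V (Atom a) \<longleftrightarrow> atom_in V a"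
| "qf_in V (Neg p) \<longleftrightarrow> qf_in V p"
| "qf_in V (And p q) \<longleftrightarrow> qf_in V p \<and> qf_in V q"
| "qf_in V (Or p q) \<longleftrightarrow> qf_in V p \<and> qf_in V q"

primrec qf_sat :: "('a, 'f, 'r) model \<Rightarrow> (nat \<Rightarrow> 'a) \<Rightarrow> ('f, 'r) qf \<Rightarrow> bool"
where
  "qf_sat M v Bot \<longleftrightarrow> False"
| "qf_sat M v (Atom a) \<longleftrightarrow> atom_sat M v a"
| "qf_sat M v (Neg p) \<longleftrightarrow> \<not> qf_sat M v p"
| "qf_sat M v (And p q) \<longleftrightarrow> qf_sat M v p \<and> qf_sat M v q"
| "qf_sat M v (Or p q) \<longleftrightarrow> qf_sat M v p \<or> qf_sat M v q"

subsection \<open>The infinitary hierarchy\<close>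

text \<open>\<open>OrEx X F\<close> is the countable disjunction over \<open>n\<close> of the formulas \<open>\<exists>x\<^sub>1 \<dots> x\<^sub>k. F n\<close> with
  \<open>X n = [x\<^sub>1, \<dots>, x\<^sub>k]\<close>, and \<open>AndAll X F\<close> is its dual. Finite disjunctions (conjunctions)
  are obtained by repeating members, the empty ones by taking \<open>Bot\<close> (\<open>Neg Bot\<close>)
  for every member.\<close>

datatype ('f, 'r) fm = QF "('f, 'r) qf"
  | OrEx "nat \<Rightarrow> nat list" "nat \<Rightarrow> ('f, 'r) fm"
  | AndAll "nat \<Rightarrow> nat list" "nat \<Rightarrow> ('f, 'r) fm"

primrec fm_vars :: "('f, 'r) fm \<Rightarrow> nat set"
where
  "fm_vars (QF p) = qf_vars p"
| "fm_vars (OrEx X F) = (\<Union>n. fm_vars (F n) - set (X n))"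
| "fm_vars (AndAll X F) = (\<Union>n. fm_vars (F n) - set (X n))"

primrec fm_in :: "('f, 'r) vocabulary \<Rightarrow> ('f, 'r) fm \<Rightarrow> bool"
where
  "fm_in V (QF p) \<longleftrightarrow> qf_in V p"
| "fm_in V (OrEx X F) \<longleftrightarrow> (\<forall>n. fm_in V (F n))"
| "fm_in V (AndAll X F) \<longleftrightarrow> (\<forall>n. fm_in V (F n))"

definition reassign :: "('a, 'f, 'r) model \<Rightarrow> nat list \<Rightarrow> (nat \<Rightarrow> 'a) \<Rightarrow> (nat \<Rightarrow> 'a) set"
  where "reassign M xs v = {w. \<forall>i. if i \<in> set xs then w i \<in> univ M else w i = v i}"

primrec fm_sat :: "('a, 'f, 'r) model \<Rightarrow> (nat \<Rightarrow> 'a) \<Rightarrow> ('f, 'r) fm \<Rightarrow> bool"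
where
  "fm_sat M v (QF p) \<longleftrightarrow> qf_sat M v p"
| "fm_sat M v (OrEx X F) \<longleftrightarrow> (\<exists>n. \<exists>w\<in>reassign M (X n) v. fm_sat M w (F n))"
| "fm_sat M v (AndAll X F) \<longleftrightarrow> (\<forall>n. \<forall>w\<in>reassign M (X n) v. fm_sat M w (F n))"

inductive Sigma_in :: "omega1 \<Rightarrow> ('f, 'r) fm \<Rightarrow> bool"
  and Pi_in :: "omega1 \<Rightarrow> ('f, 'r) fm \<Rightarrow> bool"
where
  Sigma_0: "Sigma_in 0 (QF p)"
| Pi_0: "Pi_in 0 (QF p)"
| Sigma_step: "0 < \<alpha> \<Longrightarrow> (\<And>n. \<exists>\<beta><\<alpha>. Pi_in \<beta> (F n)) \<Longrightarrow> Sigma_in \<alpha> (OrEx X F)"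
| Pi_step: "0 < \<alpha> \<Longrightarrow> (\<And>n. \<exists>\<beta><\<alpha>. Sigma_in \<beta> (F n)) \<Longrightarrow> Pi_in \<alpha> (AndAll X F)"

subsection \<open>Parameterless Scott rank\<close>

text \<open>The tuple \<open>as\<close> is assigned to the variables \<open>0, \<dots>, length as - 1\<close>; the values of
  \<open>(!) as\<close> beyond its length are irrelevant because of the condition on the free variables.\<close>

definition Sigma_definable ::
  "('f, 'r) vocabulary \<Rightarrow> ('a, 'f, 'r) model \<Rightarrow> omega1 \<Rightarrow> nat \<Rightarrow> 'a list set \<Rightarrow> bool"
  where "Sigma_definable V M \<alpha> n S \<longleftrightarrow>
    (\<exists>\<phi>. Sigma_in \<alpha> \<phi> \<and> fm_in V \<phi> \<and> fm_vars \<phi> \<subseteq> {..<n} \<and>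
         S = {as \<in> tuples M n. fm_sat M ((!) as) \<phi>})"

definition scott_rank :: "('f, 'r) vocabulary \<Rightarrow> ('a, 'f, 'r) model \<Rightarrow> omega1"
  where "scott_rank V M =
    (LEAST \<alpha>. \<forall>as\<in>lists (univ M). Sigma_definable V M \<alpha> (length as) (orbit V M as))"

subsection \<open>Labelled trees\<close>

text \<open>The labelling \<open>l\<close> with values in the natural numbers is rendered by the unary predicates
  \<open>l(x) = n\<close>. Trees are prefix-closed sets of lists; the root is its own parent.\<close>

datatype tree_fun = Parent
datatype tree_rel = Below | Label nat

definition tree_vocabulary :: "(tree_fun, tree_rel) vocabulary"
  where "tree_vocabulary = \<lparr>Funs = UNIV, Rels = UNIV, fun_arity = (\<lambda>_. 1),
    rel_arity = (\<lambda>r. case r of Below \<Rightarrow> 2 | Label n \<Rightarrow> 1)\<rparr>"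

definition labelled_tree ::
  "'b list set \<Rightarrow> ('b list \<Rightarrow> nat) \<Rightarrow> ('b list, tree_fun, tree_rel) model"
  where "labelled_tree T l = \<lparr>univ = T,
    fun_int = (\<lambda>_ xs. butlast (xs ! 0)),
    rel_int = (\<lambda>r xs. case r of Below \<Rightarrow> prefix (xs ! 0) (xs ! 1) | Label n \<Rightarrow> l (xs ! 0) = n)\<rparr>"

text \<open>Every step of a branch carries a copy number: the nodes \<open>\<tau> @ [(a, k)]\<close>, for varying \<open>k\<close>,
  are the infinitely many copies of a child, with isomorphic labelled subtrees above them.\<close>

definition replicated_tree ::
  "'b list set \<Rightarrow> ('b list \<Rightarrow> nat) \<Rightarrow> (('b \<times> nat) list, tree_fun, tree_rel) model"
  where "replicated_tree T l = labelled_tree {\<sigma>. map fst \<sigma> \<in> T} (\<lambda>\<sigma>. l (map fst \<sigma>))"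

subsection \<open>The tree of tuples\<close>

text \<open>The finite atomic diagram of a tuple of length \<open>n\<close> records the truth values of the first \<open>n\<close>
  atomic formulas in a fixed enumeration \<open>e\<close> of all atomic formulas of the vocabulary; a
  formula with a variable that is not assigned by the tuple gets the value \<open>False\<close>.\<close>

definition enumerates_atoms :: "('f, 'r) vocabulary \<Rightarrow> (nat \<Rightarrow> ('f, 'r) atom) \<Rightarrow> bool"
  where "enumerates_atoms V e \<longleftrightarrow> range e = {a. atom_in V a}"

definition finite_diagram ::
  "(nat \<Rightarrow> ('f, 'r) atom) \<Rightarrow> ('a, 'f, 'r) model \<Rightarrow> 'a list \<Rightarrow> bool list"
  where "finite_diagram e A as =
    map (\<lambda>i. atom_vars (e i) \<subseteq> {..<length as} \<and> atom_sat A ((!) as) (e i)) [0..<length as]"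

definition tuple_label :: "(nat \<Rightarrow> ('f, 'r) atom) \<Rightarrow> ('a, 'f, 'r) model \<Rightarrow> 'a list \<Rightarrow> nat"
  where "tuple_label e A as = to_nat (length as, finite_diagram e A as)"

definition tree_of_tuples ::
  "(nat \<Rightarrow> ('f, 'r) atom) \<Rightarrow> ('a, 'f, 'r) model \<Rightarrow> (('a \<times> nat) list, tree_fun, tree_rel) model"
  where "tree_of_tuples e A = replicated_tree (lists (univ A)) (tuple_label e A)"

end

theory Submission
  imports Defs
begin

text \<open>
  A node of the tree is a tuple of \<open>A\<close> together with a list of copy numbers, so \<open>\<T>\<^sub>A\<close> is interpreted in
  \<open>A\<close>: for fixed copy numbers, atomic facts about nodes are finitary quantifier-free facts about the
  tuples, and a quantifier over nodes is a countable disjunction of quantifiers over tuples.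
  Hence \<open>\<Sigma>\<^sub>\<alpha>\<close> relations of the tree pull back to \<open>\<Sigma>\<^sub>\<alpha>\<close> relations of \<open>A\<close> for every \<open>\<alpha>\<close>.
  Conversely, an existential quantifier over \<open>A\<close> is a quantifier over the extensions of a node, and a
  quantifier-free condition is read off the label of any sufficiently long extension; so for \<open>\<alpha> \<ge> 1\<close> a
  \<open>\<Sigma>\<^sub>\<alpha>\<close> relation of \<open>A\<close> gives a \<open>\<Sigma>\<^sub>\<alpha>\<close> set of nodes.
  Two back-and-forth arguments match the orbits: two tuples of nodes lie in the same orbit iff they
  have the same finite tree structure and corresponding nodes carry tuples in the same orbit of \<open>A\<close>.
  So the two structures have orbits definable at exactly the same levels \<open>\<alpha> \<ge> 1\<close>, and definability at
  level \<open>0\<close> passes from the tree to \<open>A\<close>.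
\<close>

section \<open>Assignments and renaming of variables\<close>

text \<open>The label of a node of length n shows only the first n atoms of \<open>e\<close>, and
  this delay shapes both halves of the proof. Equal labels at one pair of nodes say little about the
  two tuples, so the back-and-forth criterion asks for agreement on an atom only past a threshold
  depending on that atom. Reading a quantifier-free condition of A in the tree costs a quantifier
  over extensions; it merges with an existing block at levels \<alpha> \<ge> 1 and is missing at
  level 0. This is why rank 0 of A only gives the bound 1 for the tree.

  Orbits of several nodes split into conditions on single nodes because nothing in the tree relates
  the tuples at two nodes beyond their common initial segment. Infinite replication makes finite
  patterns of meets extendable: an image can leave all nodes used so far at exactly the prescribed
  height.\<close>

lemma tm_val_cong: "(\<And>i. i \<in> tm_vars t \<Longrightarrow> v i = w i) \<Longrightarrow> tm_val M v t = tm_val M w t"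
proof (induction t)
  case (App f ts)
  have "map (tm_val M v) ts = map (tm_val M w) ts"
    using App by (auto intro!: map_cong)
  then show ?case by (simp only: tm_val.simps)
qed simp

lemma atom_sat_cong: "(\<And>i. i \<in> atom_vars a \<Longrightarrow> v i = w i) \<Longrightarrow> atom_sat M v a = atom_sat M w a"
proof (cases a)
  case (Eq s t)
  moreover assume "\<And>i. i \<in> atom_vars a \<Longrightarrow> v i = w i"
  ultimately have "tm_val M v s = tm_val M w s" "tm_val M v t = tm_val M w t"
    by (auto intro: tm_val_cong)
  then show ?thesis using Eq by simp
next
  case (Rel r ts)
  moreover assume "\<And>i. i \<in> atom_vars a \<Longrightarrow> v i = w i"
  ultimately have "map (tm_val M v) ts = map (tm_val M w) ts"
    by (auto intro!: map_cong tm_val_cong)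
  then show ?thesis using Rel by (simp only: atom_sat.simps)
qed

lemma qf_sat_cong: "(\<And>i. i \<in> qf_vars p \<Longrightarrow> v i = w i) \<Longrightarrow> qf_sat M v p = qf_sat M w p"
proof (induction p)
  case (Atom a)
  then show ?case using atom_sat_cong[of a v w M] by simp
next
  case (Neg p)
  have "qf_sat M v p = qf_sat M w p" by (rule Neg.IH) (simp add: Neg.prems)
  then show ?case by simp
next
  case (And p q)
  have "qf_sat M v p = qf_sat M w p" by (rule And.IH) (simp add: And.prems)
  moreover have "qf_sat M v q = qf_sat M w q" by (rule And.IH) (simp add: And.prems)
  ultimately show ?case by simp
next
  case (Or p q)
  have "qf_sat M v p = qf_sat M w p" by (rule Or.IH) (simp add: Or.prems)
  moreover have "qf_sat M v q = qf_sat M w q" by (rule Or.IH) (simp add: Or.prems)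
  ultimately show ?case by simp
qed simp

text \<open>The quantifier case of the coincidence lemma: \<open>u\<close> is kept on
  \<open>xs\<close> and replaced by \<open>w\<close> elsewhere.\<close>

lemma reassign_agree:
  assumes "u \<in> reassign M xs v" "\<And>i. i \<in> B - set xs \<Longrightarrow> v i = w i"
  obtains u' where "u' \<in> reassign M xs w" "\<And>i. i \<in> B \<Longrightarrow> u i = u' i"
proof
  let ?u = "\<lambda>i. if i \<in> set xs then u i else w i"
  show "?u \<in> reassign M xs w" using assms(1) by (auto simp: reassign_def split: if_splits)
  show "u i = ?u i" if "i \<in> B" for i
    using assms that by (auto simp: reassign_def split: if_splits)
qed

lemma fm_sat_cong: "(\<And>i. i \<in> fm_vars \<phi> \<Longrightarrow> v i = w i) \<Longrightarrow> fm_sat M v \<phi> = fm_sat M w \<phi>"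
proof (induction \<phi> arbitrary: v w)
  case (QF p)
  then show ?case using qf_sat_cong[of p v w M] by simp
next
  case (OrEx X F)
  \<comment> \<open>\<open>v\<close> and \<open>w\<close> are generalised here, so that this
    one-sided transfer yields both directions.\<close>
  have *: "\<exists>u'\<in>reassign M (X n) w. fm_sat M u' (F n)"
    if u: "u \<in> reassign M (X n) v" "fm_sat M u (F n)"
      and vw: "\<And>i. i \<in> fm_vars (F n) - set (X n) \<Longrightarrow> v i = w i" for u n v w
  proof -
    obtain u' where u': "u' \<in> reassign M (X n) w" "\<And>i. i \<in> fm_vars (F n) \<Longrightarrow> u i = u' i"
      using reassign_agree[OF u(1) vw] by blast
    have "fm_sat M u (F n) = fm_sat M u' (F n)"
      using u'(2) by (rule OrEx.IH[OF rangeI])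
    then show ?thesis using u' u(2) by blast
  qed
  have vw: "v i = w i" if "i \<in> fm_vars (F n) - set (X n)" for i n
    using OrEx.prems that by auto
  have "(\<exists>u\<in>reassign M (X n) v. fm_sat M u (F n)) \<longleftrightarrow> (\<exists>u\<in>reassign M (X n) w. fm_sat M u (F n))" for n
    using *[of _ n v w] *[of _ n w v] vw[of _ n] vw[of _ n, symmetric] by blast
  then show ?case by simp
next
  case (AndAll X F)
  have *: "fm_sat M u (F n)"
    if u: "u \<in> reassign M (X n) v" "\<forall>u\<in>reassign M (X n) w. fm_sat M u (F n)"
      and vw: "\<And>i. i \<in> fm_vars (F n) - set (X n) \<Longrightarrow> v i = w i" for u n v w
  proof -
    obtain u' where u': "u' \<in> reassign M (X n) w" "\<And>i. i \<in> fm_vars (F n) \<Longrightarrow> u i = u' i"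
      using reassign_agree[OF u(1) vw] by blast
    have "fm_sat M u (F n) = fm_sat M u' (F n)"
      using u'(2) by (rule AndAll.IH[OF rangeI])
    then show ?thesis using u' u(2) by blast
  qed
  have vw: "v i = w i" if "i \<in> fm_vars (F n) - set (X n)" for i n
    using AndAll.prems that by auto
  have "(\<forall>u\<in>reassign M (X n) v. fm_sat M u (F n)) \<longleftrightarrow> (\<forall>u\<in>reassign M (X n) w. fm_sat M u (F n))" for n
    using *[of _ n v w] *[of _ n w v] vw[of _ n] vw[of _ n, symmetric] by blast
  then show ?case by simp
qed

text \<open>Only finitary formulas are renamed, where no variable is bound and capture cannot arise.
  For infinitary formulas the renaming is carried by the assignment or by a list of tuple
  positions.\<close>

primrec tm_rename :: "(nat \<Rightarrow> nat) \<Rightarrow> 'f tm \<Rightarrow> 'f tm"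
where
  "tm_rename \<rho> (Var i) = Var (\<rho> i)"
| "tm_rename \<rho> (App f ts) = App f (map (tm_rename \<rho>) ts)"

primrec atom_rename :: "(nat \<Rightarrow> nat) \<Rightarrow> ('f, 'r) atom \<Rightarrow> ('f, 'r) atom"
where
  "atom_rename \<rho> (Eq s t) = Eq (tm_rename \<rho> s) (tm_rename \<rho> t)"
| "atom_rename \<rho> (Rel r ts) = Rel r (map (tm_rename \<rho>) ts)"

primrec qf_rename :: "(nat \<Rightarrow> nat) \<Rightarrow> ('f, 'r) qf \<Rightarrow> ('f, 'r) qf"
where
  "qf_rename \<rho> Bot = Bot"
| "qf_rename \<rho> (Atom a) = Atom (atom_rename \<rho> a)"
| "qf_rename \<rho> (Neg p) = Neg (qf_rename \<rho> p)"
| "qf_rename \<rho> (And p q) = And (qf_rename \<rho> p) (qf_rename \<rho> q)"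
| "qf_rename \<rho> (Or p q) = Or (qf_rename \<rho> p) (qf_rename \<rho> q)"

lemma tm_vars_rename: "tm_vars (tm_rename \<rho> t) = \<rho> ` tm_vars t"
  by (induction t) auto

lemma tm_in_rename: "tm_in V (tm_rename \<rho> t) = tm_in V t"
  by (induction t) (auto simp: list_all_iff)

lemma tm_val_rename: "tm_val M v (tm_rename \<rho> t) = tm_val M (\<lambda>i. v (\<rho> i)) t"
proof (induction t)
  case (App f ts)
  have "map (tm_val M v) (map (tm_rename \<rho>) ts) = map (tm_val M (\<lambda>i. v (\<rho> i))) ts"
    using App by auto
  then show ?case by (simp del: map_map)
qed simp

lemma atom_vars_rename: "atom_vars (atom_rename \<rho> a) = \<rho> ` atom_vars a"
  by (cases a) (auto simp: tm_vars_rename)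

lemma atom_in_rename: "atom_in V (atom_rename \<rho> a) = atom_in V a"
  by (cases a) (auto simp: tm_in_rename)

lemma atom_sat_rename: "atom_sat M v (atom_rename \<rho> a) = atom_sat M (\<lambda>i. v (\<rho> i)) a"
  by (cases a) (auto simp: tm_val_rename o_def)

lemma qf_vars_rename: "qf_vars (qf_rename \<rho> p) = \<rho> ` qf_vars p"
  by (induction p) (auto simp: atom_vars_rename)

lemma qf_in_rename: "qf_in V (qf_rename \<rho> p) = qf_in V p"
  by (induction p) (auto simp: atom_in_rename)

lemma qf_sat_rename: "qf_sat M v (qf_rename \<rho> p) = qf_sat M (\<lambda>i. v (\<rho> i)) p"
  by (induction p) (auto simp: atom_sat_rename)

section \<open>Quantifier-free definable relations\<close>

definition qf_definable ::
  "('f, 'r) vocabulary \<Rightarrow> ('a, 'f, 'r) model \<Rightarrow> nat \<Rightarrow> ('a list \<Rightarrow> bool) \<Rightarrow> bool"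
  where "qf_definable V M n P \<longleftrightarrow>
    (\<exists>p. qf_in V p \<and> qf_vars p \<subseteq> {..<n} \<and> (\<forall>as\<in>tuples M n. qf_sat M ((!) as) p \<longleftrightarrow> P as))"

lemma qf_definable_cong:
  "qf_definable V M n P \<Longrightarrow> (\<And>as. as \<in> tuples M n \<Longrightarrow> P as \<longleftrightarrow> Q as) \<Longrightarrow> qf_definable V M n Q"
  unfolding qf_definable_def by metis

lemma qf_definable_const: "qf_definable V M n (\<lambda>_. b)"
  unfolding qf_definable_def
  by (cases b; rule exI[of _ "if b then Neg Bot else Bot"]) auto

lemma qf_definable_not: "qf_definable V M n P \<Longrightarrow> qf_definable V M n (\<lambda>as. \<not> P as)"
  unfolding qf_definable_def by (metis qf_in.simps(3) qf_sat.simps(3) qf_vars.simps(3))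

lemma qf_definable_and:
  assumes "qf_definable V M n P" "qf_definable V M n Q"
  shows "qf_definable V M n (\<lambda>as. P as \<and> Q as)"
proof -
  obtain p q where "qf_in V p" "qf_vars p \<subseteq> {..<n}" "\<forall>as\<in>tuples M n. qf_sat M ((!) as) p \<longleftrightarrow> P as"
    "qf_in V q" "qf_vars q \<subseteq> {..<n}" "\<forall>as\<in>tuples M n. qf_sat M ((!) as) q \<longleftrightarrow> Q as"
    using assms unfolding qf_definable_def by blast
  then show ?thesis
    unfolding qf_definable_def by (intro exI[of _ "And p q"]) auto
qed

lemma qf_definable_or:
  "qf_definable V M n P \<Longrightarrow> qf_definable V M n Q \<Longrightarrow> qf_definable V M n (\<lambda>as. P as \<or> Q as)"
  using qf_definable_not[OF qf_definable_and[OF qf_definable_not qf_definable_not]] by fastforce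

lemma qf_definable_iff:
  "qf_definable V M n P \<Longrightarrow> qf_definable V M n Q \<Longrightarrow> qf_definable V M n (\<lambda>as. P as \<longleftrightarrow> Q as)"
  unfolding iff_conv_conj_imp imp_conv_disj
  by (intro qf_definable_and qf_definable_or qf_definable_not)

lemma qf_definable_Ball:
  assumes "finite I" "\<And>i. i \<in> I \<Longrightarrow> qf_definable V M n (P i)"
  shows "qf_definable V M n (\<lambda>as. \<forall>i\<in>I. P i as)"
  using assms
proof (induction I rule: finite_induct)
  case empty
  show ?case using qf_definable_const[of V M n True] by simp
next
  case (insert i I)
  then show ?case using qf_definable_and[of V M n "P i" "\<lambda>as. \<forall>i\<in>I. P i as"] by simp
qed

lemma qf_definable_Bex:
  assumes "finite I" "\<And>i. i \<in> I \<Longrightarrow> qf_definable V M n (P i)"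
  shows "qf_definable V M n (\<lambda>as. \<exists>i\<in>I. P i as)"
  using qf_definable_not[OF qf_definable_Ball[OF assms(1) qf_definable_not[OF assms(2)]]] by simp

text \<open>A list of \<open>N\<close> truth values has finitely many possible values, so an
  arbitrary condition \<open>D\<close> on it is a finite Boolean combination. The induction splits
  off the last bit and absorbs it into \<open>D\<close>.\<close>

lemma qf_definable_map_upt:
  assumes "\<And>i. i < N \<Longrightarrow> qf_definable V M n (P i)"
  shows "qf_definable V M n (\<lambda>as. D (map (\<lambda>i. P i as) [0..<N]))"
  using assms
proof (induction N arbitrary: D)
  case 0
  show ?case by (simp add: qf_definable_const)
next
  case (Suc N)
  have "qf_definable V M n (\<lambda>as. (P N as \<and> D (map (\<lambda>i. P i as) [0..<N] @ [True])) \<or>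
      (\<not> P N as \<and> D (map (\<lambda>i. P i as) [0..<N] @ [False])))"
    using Suc.IH[of "\<lambda>xs. D (xs @ [True])"] Suc.IH[of "\<lambda>xs. D (xs @ [False])"] Suc.prems
    by (intro qf_definable_or qf_definable_and qf_definable_not) auto
  then show ?case
  proof (rule qf_definable_cong)
    fix as
    show "(P N as \<and> D (map (\<lambda>i. P i as) [0..<N] @ [True]) \<or>
        \<not> P N as \<and> D (map (\<lambda>i. P i as) [0..<N] @ [False])) =
      D (map (\<lambda>i. P i as) [0..<Suc N])"
      by (cases "P N as") simp_all
  qed
qed

lemma qf_definable_rename:
  assumes "qf_in V p" "\<And>i. i \<in> qf_vars p \<Longrightarrow> \<rho> i < n"
  shows "qf_definable V M n (\<lambda>as. qf_sat M (\<lambda>i. as ! \<rho> i) p)"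
  unfolding qf_definable_def using assms
  by (intro exI[of _ "qf_rename \<rho> p"]) (auto simp: qf_in_rename qf_vars_rename qf_sat_rename)

lemma qf_definable_atom:
  assumes "atom_in V a" "\<And>i. i \<in> atom_vars a \<Longrightarrow> \<rho> i < n"
  shows "qf_definable V M n (\<lambda>as. atom_sat M (\<lambda>i. as ! \<rho> i) a)"
  using qf_definable_rename[of V "Atom a" \<rho> n M] assms by simp

section \<open>The infinitary hierarchy of relations\<close>

text \<open>A name-free form of \<open>\<Sigma>\<close>-definability: \<open>\<Pi>\<close>-relations enter as complements, so that a single
  induction treats both sides of the hierarchy.\<close>

inductive Sigma_rel ::
  "('f, 'r) vocabulary \<Rightarrow> ('a, 'f, 'r) model \<Rightarrow> omega1 \<Rightarrow> nat \<Rightarrow> 'a list set \<Rightarrow> bool"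
  for V M
where
  Sigma_rel_0: "qf_definable V M n P \<Longrightarrow> Sigma_rel V M 0 n {as \<in> tuples M n. P as}"
| Sigma_rel_step: "0 < \<alpha> \<Longrightarrow> (\<And>i::nat. \<exists>\<beta><\<alpha>. Sigma_rel V M \<beta> (n + k i) (R i)) \<Longrightarrow>
    Sigma_rel V M \<alpha> n {as \<in> tuples M n. \<exists>i. \<exists>bs\<in>tuples M (k i). as @ bs \<notin> R i}"

lemma tuples_append: "as \<in> tuples M m \<Longrightarrow> bs \<in> tuples M n \<Longrightarrow> as @ bs \<in> tuples M (m + n)"
  by (auto simp: tuples_def)

lemma omega1_zero_le [simp]: "(0::omega1) \<le> \<alpha>"
  unfolding zero_omega1_def by (rule Least_le) simp

text \<open>The \<open>LEAST\<close> defining \<open>1\<close> is meaningful only once some ordinal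
  is positive, which the infinity of the type provides.\<close>

lemma omega1_zero_less_one: "(0::omega1) < 1"
proof -
  have "infinite (Field (cardSuc natLeq))"
    using cardSuc_finite[OF natLeq_Card_order] by (simp add: Field_natLeq)
  then have "infinite (UNIV :: omega1 set)"
    using type_definition.Rep_range[OF type_definition_omega1] by (metis finite_imageI)
  then obtain \<beta> :: omega1 where "\<beta> \<noteq> 0"
    by (metis UNIV_eq_I finite.emptyI finite.insertI singletonI)
  then have "(0::omega1) < \<beta>" by (simp add: less_le)
  then show ?thesis unfolding one_omega1_def by (rule LeastI)
qed

lemma Sigma_rel_subset: "Sigma_rel V M \<alpha> n S \<Longrightarrow> S \<subseteq> tuples M n"
  by (induction rule: Sigma_rel.induct) auto

lemma Sigma_rel_zeroD:
  assumes "Sigma_rel V M 0 n S"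
  shows "qf_definable V M n (\<lambda>as. as \<in> S)"
  using assms
proof cases
  case (Sigma_rel_0 P)
  then show ?thesis by (auto intro: qf_definable_cong)
qed simp

lemma Sigma_rel_zeroI:
  assumes "qf_definable V M n (\<lambda>as. as \<in> S)" "S \<subseteq> tuples M n"
  shows "Sigma_rel V M 0 n S"
proof -
  have "{as \<in> tuples M n. as \<in> S} = S" using assms(2) by blast
  then show ?thesis using Sigma_rel_0[OF assms(1)] by simp
qed

lemma Sigma_rel_zero_compl:
  assumes "Sigma_rel V M 0 n S"
  shows "Sigma_rel V M 0 n (tuples M n - S)"
  using Sigma_rel_0[OF qf_definable_not[OF Sigma_rel_zeroD[OF assms]]]
  by (simp add: set_diff_eq)

lemma Sigma_rel_stepE:
  assumes "Sigma_rel V M \<alpha> n S" "0 < \<alpha>"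
  obtains k R where "\<forall>i::nat. \<exists>\<beta><\<alpha>. Sigma_rel V M \<beta> (n + k i) (R i)"
    "S = {as \<in> tuples M n. \<exists>i. \<exists>bs\<in>tuples M (k i). as @ bs \<notin> R i}"
  using assms by cases auto

text \<open>The step rule is indexed by \<open>nat\<close>. Other index sets, such as sums, pairs
  and shapes, are enumerated with repetitions by \<open>from_nat_into\<close>, which leaves the
  empty set as a separate case.\<close>

lemma Sigma_rel_countable:
  assumes "0 < \<alpha>" "countable I" "\<And>i. i \<in> I \<Longrightarrow> \<exists>\<beta><\<alpha>. Sigma_rel V M \<beta> (n + k i) (R i)"
  shows "Sigma_rel V M \<alpha> n {as \<in> tuples M n. \<exists>i\<in>I. \<exists>bs\<in>tuples M (k i). as @ bs \<notin> R i}"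
proof (cases "I = {}")
  case True
  \<comment> \<open>The empty disjunction: every member has an empty quantifier block and asks a
    tuple to lie outside the full relation.\<close>
  have "Sigma_rel V M 0 (n + 0) (tuples M n)"
    using Sigma_rel_0[OF qf_definable_const[of V M n True]] by simp
  then have "Sigma_rel V M \<alpha> n {as \<in> tuples M n. \<exists>i::nat. \<exists>bs\<in>tuples M 0. as @ bs \<notin> tuples M n}"
    using assms(1) by (intro Sigma_rel_step) auto
  moreover have "{as \<in> tuples M n. \<exists>i::nat. \<exists>bs\<in>tuples M 0. as @ bs \<notin> tuples M n} = {}"
    by (auto simp: tuples_def)
  ultimately have "Sigma_rel V M \<alpha> n {}" by (simp only:)
  then show ?thesis using True by simp
next
  case False
  let ?f = "from_nat_into I"
  have range: "range ?f = I" using False assms(2) by (rule range_from_nat_into)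
  have "Sigma_rel V M \<alpha> n {as \<in> tuples M n. \<exists>i. \<exists>bs\<in>tuples M (k (?f i)). as @ bs \<notin> R (?f i)}"
    using assms(1) assms(3)[OF from_nat_into[OF False]] by (rule Sigma_rel_step)
  moreover have "{as \<in> tuples M n. \<exists>i. \<exists>bs\<in>tuples M (k (?f i)). as @ bs \<notin> R (?f i)} =
      {as \<in> tuples M n. \<exists>i\<in>range ?f. \<exists>bs\<in>tuples M (k i). as @ bs \<notin> R i}"
    by blast
  ultimately show ?thesis by (simp only: range)
qed

lemma Sigma_rel_mono:
  assumes "Sigma_rel V M \<alpha> n S" "\<alpha> \<le> \<beta>"
  shows "Sigma_rel V M \<beta> n S"
proof (cases "\<alpha> = 0")
  case True
  show ?thesis
  proof (cases "\<beta> = 0")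
    case False
    then have "0 < \<beta>" by (simp add: less_le)
    \<comment> \<open>Leaving level 0 changes the form: \<open>S\<close> becomes a disjunction with
      empty blocks whose members are the complement of this complement.\<close>
    moreover have "Sigma_rel V M 0 (n + 0) (tuples M n - S)"
      using Sigma_rel_zero_compl assms(1) True by simp
    ultimately have "Sigma_rel V M \<beta> n {as \<in> tuples M n. \<exists>i::nat. \<exists>bs\<in>tuples M 0. as @ bs \<notin> tuples M n - S}"
      by (intro Sigma_rel_step) auto
    moreover have "{as \<in> tuples M n. \<exists>i::nat. \<exists>bs\<in>tuples M 0. as @ bs \<notin> tuples M n - S} = S"
      using Sigma_rel_subset[OF assms(1)] by (auto simp: tuples_def)
    ultimately show ?thesis by (simp only:)
  qed (use assms True in simp)
next
  case False
  then have pos: "0 < \<alpha>" by (simp add: less_le)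
  obtain k R where R: "\<forall>i::nat. \<exists>\<beta><\<alpha>. Sigma_rel V M \<beta> (n + k i) (R i)"
    and S: "S = {as \<in> tuples M n. \<exists>i. \<exists>bs\<in>tuples M (k i). as @ bs \<notin> R i}"
    by (rule Sigma_rel_stepE[OF assms(1) pos])
  show ?thesis
    unfolding S using R assms(2) pos by (intro Sigma_rel_step) (auto intro: less_le_trans)
qed

section \<open>Substitution of positions and Boolean operations\<close>

lemma map_nth_in_tuples:
  "as \<in> tuples M m \<Longrightarrow> set ps \<subseteq> {..<m} \<Longrightarrow> map ((!) as) ps \<in> tuples M (length ps)"
  unfolding tuples_def by (auto simp: in_lists_conv_set subset_iff)

text \<open>\<open>ps\<close> may permute, repeat or omit positions of the given tuple. This
  supplies the dummy variables needed to combine relations of different arities.\<close>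

lemma Sigma_rel_reindex:
  assumes "Sigma_rel V M \<alpha> n S" "length ps = n" "set ps \<subseteq> {..<m}"
  shows "Sigma_rel V M \<alpha> m {as \<in> tuples M m. map ((!) as) ps \<in> S}"
  using assms
proof (induction arbitrary: m ps rule: Sigma_rel.induct)
  case (Sigma_rel_0 n P)
  have in_tuples: "map ((!) as) ps \<in> tuples M n" if "as \<in> tuples M m" for as
    using map_nth_in_tuples[OF that] Sigma_rel_0.prems by blast
  obtain p where p: "qf_in V p" "qf_vars p \<subseteq> {..<n}" "\<forall>as\<in>tuples M n. qf_sat M ((!) as) p \<longleftrightarrow> P as"
    using Sigma_rel_0.hyps unfolding qf_definable_def by blast
  have "qf_definable V M m (\<lambda>as. qf_sat M (\<lambda>i. as ! (ps ! i)) p)"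
    using p Sigma_rel_0.prems by (intro qf_definable_rename) (auto simp: subset_iff)
  then have "qf_definable V M m (\<lambda>as. P (map ((!) as) ps))"
  proof (rule qf_definable_cong)
    fix as assume as: "as \<in> tuples M m"
    have "qf_sat M (\<lambda>i. as ! (ps ! i)) p = qf_sat M ((!) (map ((!) as) ps)) p"
      using p(2) Sigma_rel_0.prems by (intro qf_sat_cong) auto
    then show "qf_sat M (\<lambda>i. as ! (ps ! i)) p = P (map ((!) as) ps)"
      using p(3) in_tuples[OF as] by simp
  qed
  then have "Sigma_rel V M 0 m {as \<in> tuples M m. P (map ((!) as) ps)}"
    by (rule Sigma_rel.Sigma_rel_0)
  moreover have "{as \<in> tuples M m. P (map ((!) as) ps)} =
      {as \<in> tuples M m. map ((!) as) ps \<in> {as \<in> tuples M n. P as}}"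
    using in_tuples by blast
  ultimately show ?case by simp
next
  case (Sigma_rel_step \<alpha> n k R)
  \<comment> \<open>The quantified block sits behind position \<open>m\<close>, so the list of
    positions grows by these new ones.\<close>
  let ?ps = "\<lambda>i. ps @ [m..<m + k i]"
  have app: "map ((!) (as @ bs)) (?ps i) = map ((!) as) ps @ bs"
    if "as \<in> tuples M m" "bs \<in> tuples M (k i)" for as bs i
    using that Sigma_rel_step.prems
    by (intro nth_equalityI) (auto simp: tuples_def nth_append subset_iff)
  have "Sigma_rel V M \<alpha> m {as \<in> tuples M m. \<exists>i. \<exists>bs\<in>tuples M (k i).
      as @ bs \<notin> {as \<in> tuples M (m + k i). map ((!) as) (?ps i) \<in> R i}}"
  proof (rule Sigma_rel.Sigma_rel_step[OF \<open>0 < \<alpha>\<close>])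
    fix i
    obtain \<beta> where "\<beta> < \<alpha>" and IH: "\<And>m ps. length ps = n + k i \<Longrightarrow> set ps \<subseteq> {..<m} \<Longrightarrow>
        Sigma_rel V M \<beta> m {as \<in> tuples M m. map ((!) as) ps \<in> R i}"
      using Sigma_rel_step.IH by blast
    then show "\<exists>\<beta><\<alpha>. Sigma_rel V M \<beta> (m + k i) {as \<in> tuples M (m + k i). map ((!) as) (?ps i) \<in> R i}"
      using Sigma_rel_step.prems by (intro exI[of _ \<beta>] conjI IH) auto
  qed
  moreover have "{as \<in> tuples M m. \<exists>i. \<exists>bs\<in>tuples M (k i).
      as @ bs \<notin> {as \<in> tuples M (m + k i). map ((!) as) (?ps i) \<in> R i}} =
    {as \<in> tuples M m. map ((!) as) ps \<in> {as \<in> tuples M n. \<exists>i. \<exists>bs\<in>tuples M (k i). as @ bs \<notin> R i}}"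
    (is "?L = ?R")
  proof -
    have "map ((!) as) ps \<in> tuples M n" if "as \<in> tuples M m" for as
      using map_nth_in_tuples[OF that] Sigma_rel_step.prems by blast
    moreover have "as @ bs \<notin> {as \<in> tuples M (m + k i). map ((!) as) (?ps i) \<in> R i} \<longleftrightarrow>
        map ((!) as) ps @ bs \<notin> R i" if "as \<in> tuples M m" "bs \<in> tuples M (k i)" for as bs i
      unfolding mem_Collect_eq app[OF that] using tuples_append[OF that] by blast
    ultimately show ?thesis by blast
  qed
  ultimately show ?case by (simp only:)
qed

lemma Sigma_rel_union:
  assumes "Sigma_rel V M \<alpha> n S" "Sigma_rel V M \<alpha> n S'"
  shows "Sigma_rel V M \<alpha> n (S \<union> S')"
proof (cases "\<alpha> = 0")
  case True
  then have "qf_definable V M n (\<lambda>as. as \<in> S \<or> as \<in> S')"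
    using assms by (intro qf_definable_or Sigma_rel_zeroD) simp_all
  then show ?thesis
    using assms True by (auto intro!: Sigma_rel_zeroI dest: Sigma_rel_subset)
next
  case False
  then have pos: "0 < \<alpha>" by (simp add: less_le)
  obtain k R where R: "\<forall>i::nat. \<exists>\<beta><\<alpha>. Sigma_rel V M \<beta> (n + k i) (R i)"
    and S: "S = {as \<in> tuples M n. \<exists>i. \<exists>bs\<in>tuples M (k i). as @ bs \<notin> R i}"
    by (rule Sigma_rel_stepE[OF assms(1) pos])
  obtain k' R' where R': "\<forall>i::nat. \<exists>\<beta><\<alpha>. Sigma_rel V M \<beta> (n + k' i) (R' i)"
    and S': "S' = {as \<in> tuples M n. \<exists>i. \<exists>bs\<in>tuples M (k' i). as @ bs \<notin> R' i}"
    by (rule Sigma_rel_stepE[OF assms(2) pos])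
  have "Sigma_rel V M \<alpha> n {as \<in> tuples M n. \<exists>j\<in>UNIV. \<exists>bs\<in>tuples M (case_sum k k' j). as @ bs \<notin> case_sum R R' j}"
    using R R' by (intro Sigma_rel_countable[OF pos]) (auto split: sum.split)
  moreover have "{as \<in> tuples M n. \<exists>j\<in>UNIV. \<exists>bs\<in>tuples M (case_sum k k' j). as @ bs \<notin> case_sum R R' j} = S \<union> S'"
    unfolding S S' by (auto simp: split_sum_ex)
  ultimately show ?thesis by simp
qed

text \<open>Two existential blocks merge into one: members are indexed by pairs
  \<open>(i, j)\<close> and quantify over \<open>bs @ cs\<close>. Lying outside \<open>R i\<close>
  and outside \<open>R' j\<close> is lying outside a union, so closure under unions at the larger of
  the two lower levels does the work.\<close>

lemma Sigma_rel_inter: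
  assumes "Sigma_rel V M \<alpha> n S" "Sigma_rel V M \<alpha> n S'"
  shows "Sigma_rel V M \<alpha> n (S \<inter> S')"
proof (cases "\<alpha> = 0")
  case True
  then have "qf_definable V M n (\<lambda>as. as \<in> S \<and> as \<in> S')"
    using assms by (intro qf_definable_and Sigma_rel_zeroD) simp_all
  then show ?thesis
    using assms True by (auto intro!: Sigma_rel_zeroI dest: Sigma_rel_subset)
next
  case False
  then have pos: "0 < \<alpha>" by (simp add: less_le)
  obtain k R where R: "\<forall>i::nat. \<exists>\<beta><\<alpha>. Sigma_rel V M \<beta> (n + k i) (R i)"
    and S: "S = {as \<in> tuples M n. \<exists>i. \<exists>bs\<in>tuples M (k i). as @ bs \<notin> R i}"
    by (rule Sigma_rel_stepE[OF assms(1) pos])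
  obtain k' R' where R': "\<forall>i::nat. \<exists>\<beta><\<alpha>. Sigma_rel V M \<beta> (n + k' i) (R' i)"
    and S': "S' = {as \<in> tuples M n. \<exists>i. \<exists>bs\<in>tuples M (k' i). as @ bs \<notin> R' i}"
    by (rule Sigma_rel_stepE[OF assms(2) pos])
  define len where "len = (\<lambda>(i, j). k i + k' j)"
  define ps where "ps = (\<lambda>i. [0..<n] @ [n..<n + k i])"
  \<comment> \<open>\<open>qs\<close> skips the block \<open>bs\<close>, which belongs to the first
    relation.\<close>
  define qs where "qs = (\<lambda>i j. [0..<n] @ [n + k i..<n + k i + k' j])"
  define Q where "Q = (\<lambda>(i, j). {as \<in> tuples M (n + len (i, j)). map ((!) as) (ps i) \<in> R i} \<union>
      {as \<in> tuples M (n + len (i, j)). map ((!) as) (qs i j) \<in> R' j})"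
  have "\<exists>\<beta><\<alpha>. Sigma_rel V M \<beta> (n + len x) (Q x)" for x
  proof -
    obtain i j where x: "x = (i, j)" by fastforce
    obtain \<beta> \<gamma> where b: "\<beta> < \<alpha>" "Sigma_rel V M \<beta> (n + k i) (R i)"
      and c: "\<gamma> < \<alpha>" "Sigma_rel V M \<gamma> (n + k' j) (R' j)"
      using R R' by blast
    have "Sigma_rel V M (max \<beta> \<gamma>) (n + len (i, j)) (Q (i, j))"
      unfolding Q_def prod.case
      using Sigma_rel_mono[OF b(2), of "max \<beta> \<gamma>"] Sigma_rel_mono[OF c(2), of "max \<beta> \<gamma>"]
      by (intro Sigma_rel_union Sigma_rel_reindex[of V M _ "n + k i"] Sigma_rel_reindex[of V M _ "n + k' j"])
        (auto simp: ps_def qs_def len_def)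
    then show ?thesis using b c x by (metis max_def)
  qed
  then have "Sigma_rel V M \<alpha> n {as \<in> tuples M n. \<exists>x\<in>UNIV. \<exists>bs\<in>tuples M (len x). as @ bs \<notin> Q x}"
    by (intro Sigma_rel_countable[OF pos]) auto
  moreover have "{as \<in> tuples M n. \<exists>x\<in>UNIV. \<exists>bs\<in>tuples M (len x). as @ bs \<notin> Q x} = S \<inter> S'"
  proof -
    have "(\<exists>x. \<exists>ds\<in>tuples M (len x). as @ ds \<notin> Q x) \<longleftrightarrow>
        (\<exists>i. \<exists>bs\<in>tuples M (k i). as @ bs \<notin> R i) \<and> (\<exists>j. \<exists>cs\<in>tuples M (k' j). as @ cs \<notin> R' j)"
      if as: "as \<in> tuples M n" for as
    proof -
      have Q: "as @ bs @ cs \<notin> Q (i, j) \<longleftrightarrow> as @ bs \<notin> R i \<and> as @ cs \<notin> R' j"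
        if "bs \<in> tuples M (k i)" "cs \<in> tuples M (k' j)" for i j bs cs
      proof -
        have len: "length as = n" "length bs = k i" "length cs = k' j"
          using as that by (auto simp: tuples_def)
        have "map ((!) (as @ bs @ cs)) (ps i) = as @ bs"
          unfolding ps_def using len by (intro nth_equalityI) (auto simp: nth_append)
        moreover have "map ((!) (as @ bs @ cs)) (qs i j) = as @ cs"
          unfolding qs_def using len by (intro nth_equalityI) (auto simp: nth_append)
        moreover have "as @ bs @ cs \<in> tuples M (n + len (i, j))"
          using as that by (auto simp: len_def intro: tuples_append)
        ultimately show ?thesis by (simp add: Q_def)
      qed
      have split: "(\<exists>ds\<in>tuples M (len (i, j)). as @ ds \<notin> Q (i, j)) \<longleftrightarrow>
          (\<exists>bs\<in>tuples M (k i). \<exists>cs\<in>tuples M (k' j). as @ bs @ cs \<notin> Q (i, j))" for i j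
      proof
        assume "\<exists>ds\<in>tuples M (len (i, j)). as @ ds \<notin> Q (i, j)"
        then obtain ds where ds: "ds \<in> tuples M (k i + k' j)" "as @ ds \<notin> Q (i, j)"
          by (auto simp: len_def)
        have "take (k i) ds \<in> tuples M (k i)" "drop (k i) ds \<in> tuples M (k' j)"
          using ds(1) by (auto simp: tuples_def dest: in_set_takeD in_set_dropD)
        then show "\<exists>bs\<in>tuples M (k i). \<exists>cs\<in>tuples M (k' j). as @ bs @ cs \<notin> Q (i, j)"
          using ds(2) by (metis append_take_drop_id)
      qed (auto simp: len_def intro: tuples_append)
      show ?thesis unfolding split_paired_Ex split using Q by metis
    qed
    then show ?thesis unfolding S S' by blast
  qed
  ultimately show ?thesis by simp
qed

lemma Sigma_rel_INT:
  assumes "finite I" "\<And>i. i \<in> I \<Longrightarrow> Sigma_rel V M \<alpha> n (S i)"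
  shows "Sigma_rel V M \<alpha> n {as \<in> tuples M n. \<forall>i\<in>I. as \<in> S i}"
  using assms
proof (induction I rule: finite_induct)
  case empty
  show ?case
    using Sigma_rel_mono[OF Sigma_rel_0[OF qf_definable_const[of V M n True]] omega1_zero_le] by simp
next
  case (insert i I)
  have "{as \<in> tuples M n. \<forall>j\<in>insert i I. as \<in> S j} = S i \<inter> {as \<in> tuples M n. \<forall>i\<in>I. as \<in> S i}"
    using Sigma_rel_subset[of V M \<alpha> n "S i"] insert.prems by auto
  moreover have "Sigma_rel V M \<alpha> n (S i \<inter> {as \<in> tuples M n. \<forall>i\<in>I. as \<in> S i})"
    using insert by (intro Sigma_rel_inter) auto
  ultimately show ?case by (simp only:)
qed

section \<open>Formulas with named variables and relations by position\<close>

definition extend_renaming :: "(nat \<Rightarrow> nat) \<Rightarrow> nat \<Rightarrow> nat list \<Rightarrow> nat \<Rightarrow> nat"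
  where "extend_renaming \<rho> n xs i =
    (if i \<in> set xs then n + (LEAST j. j < length xs \<and> xs ! j = i) else \<rho> i)"

text \<open>A block \<open>xs\<close> may name a variable twice. Its value is then read at the first
  occurrence and the other entries are dummies; this matches \<open>reassign\<close>, which sees
  only the set of \<open>xs\<close>.\<close>

lemma extend_renaming_in:
  assumes "i \<in> set xs"
  obtains j where "extend_renaming \<rho> n xs i = n + j" "j < length xs" "xs ! j = i"
proof -
  have "\<exists>j. j < length xs \<and> xs ! j = i" using assms by (auto simp: in_set_conv_nth)
  from LeastI_ex[OF this] show ?thesis using that assms by (auto simp: extend_renaming_def)
qed

text \<open>Trades assignments for tuples of values. \<open>B\<close> holds the variables on which
  \<open>Q\<close> depends, and \<open>Q\<close> is abstract so as to serve both a formula and its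
  negation.\<close>

lemma reassign_iff_tuple:
  assumes Q: "\<And>v w. (\<And>i. i \<in> B \<Longrightarrow> v i = w i) \<Longrightarrow> Q v = Q w"
    and as: "as \<in> tuples M n" and \<rho>: "\<And>i. i \<in> B - set xs \<Longrightarrow> \<rho> i < n"
  shows "(\<exists>w\<in>reassign M xs (\<lambda>i. as ! \<rho> i). Q w) \<longleftrightarrow>
    (\<exists>bs\<in>tuples M (length xs). Q (\<lambda>i. (as @ bs) ! extend_renaming \<rho> n xs i))"
proof
  have len: "length as = n" using as by (simp add: tuples_def)
  assume "\<exists>w\<in>reassign M xs (\<lambda>i. as ! \<rho> i). Q w"
  then obtain w where w: "w \<in> reassign M xs (\<lambda>i. as ! \<rho> i)" "Q w" by blast
  have "w i = (as @ map w xs) ! extend_renaming \<rho> n xs i" if "i \<in> B" for i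
  proof (cases "i \<in> set xs")
    case True
    then obtain j where "extend_renaming \<rho> n xs i = n + j" "j < length xs" "xs ! j = i"
      by (rule extend_renaming_in)
    then show ?thesis using len by (simp add: nth_append)
  next
    case False
    then show ?thesis
      using w(1) \<rho>[of i] that len by (auto simp: extend_renaming_def reassign_def nth_append split: if_splits)
  qed
  then have "Q w = Q (\<lambda>i. (as @ map w xs) ! extend_renaming \<rho> n xs i)" by (rule Q)
  then have "Q (\<lambda>i. (as @ map w xs) ! extend_renaming \<rho> n xs i)" using w(2) by simp
  moreover have "map w xs \<in> tuples M (length xs)"
    using w(1) by (auto simp: tuples_def reassign_def split: if_splits)
  ultimately show "\<exists>bs\<in>tuples M (length xs). Q (\<lambda>i. (as @ bs) ! extend_renaming \<rho> n xs i)" by blast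
next
  have len: "length as = n" using as by (simp add: tuples_def)
  assume "\<exists>bs\<in>tuples M (length xs). Q (\<lambda>i. (as @ bs) ! extend_renaming \<rho> n xs i)"
  then obtain bs where bs: "bs \<in> tuples M (length xs)"
    and Qbs: "Q (\<lambda>i. (as @ bs) ! extend_renaming \<rho> n xs i)" by blast
  \<comment> \<open>Off \<open>B\<close> a position \<open>\<rho> i\<close> may lie beyond
    \<open>as\<close>, where \<open>as @ bs\<close> and \<open>as\<close> can differ; so outside
    \<open>xs\<close> the old value is kept literally, as \<open>reassign\<close> demands.\<close>
  define w where "w = (\<lambda>i. if i \<in> set xs then (as @ bs) ! extend_renaming \<rho> n xs i else as ! \<rho> i)"
  have "(as @ bs) ! extend_renaming \<rho> n xs i \<in> univ M" if "i \<in> set xs" for i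
  proof -
    obtain j where "extend_renaming \<rho> n xs i = n + j" "j < length xs"
      using \<open>i \<in> set xs\<close> by (rule extend_renaming_in)
    then show ?thesis using len bs by (auto simp: nth_append tuples_def in_lists_conv_set)
  qed
  then have "w \<in> reassign M xs (\<lambda>i. as ! \<rho> i)" by (auto simp: w_def reassign_def)
  moreover have "(as @ bs) ! extend_renaming \<rho> n xs i = w i" if "i \<in> B" for i
    using that \<rho>[of i] len by (auto simp: w_def extend_renaming_def nth_append)
  then have "Q (\<lambda>i. (as @ bs) ! extend_renaming \<rho> n xs i) = Q w" by (rule Q)
  then have "Q w" using Qbs by simp
  ultimately show "\<exists>w\<in>reassign M xs (\<lambda>i. as ! \<rho> i). Q w" by blast
qed

lemma extend_renaming_vars:
  assumes "\<rho> ` (B - set xs) \<subseteq> {..<n}"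
  shows "extend_renaming \<rho> n xs ` B \<subseteq> {..<n + length xs}"
proof
  fix x assume "x \<in> extend_renaming \<rho> n xs ` B"
  then obtain i where i: "i \<in> B" "x = extend_renaming \<rho> n xs i" by blast
  show "x \<in> {..<n + length xs}"
  proof (cases "i \<in> set xs")
    case True
    then obtain j where "extend_renaming \<rho> n xs i = n + j" "j < length xs" by (rule extend_renaming_in)
    then show ?thesis using i by simp
  next
    case False
    then have "\<rho> i < n" using assms i(1) by auto
    then show ?thesis using i False by (simp add: extend_renaming_def)
  qed
qed

text \<open>\<open>\<rho>\<close> places the free variables in a tuple: bound names are arbitrary,
  so on entering a block they must be moved to the positions behind that tuple. A \<Pi> formula is
  represented by the tuples that falsify it, which is what the step rule of \<open>Sigma_rel\<close>
  consumes.\<close>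

lemma Sigma_in_imp_Sigma_rel:
  "Sigma_in \<alpha> \<phi> \<Longrightarrow> fm_in V \<phi> \<Longrightarrow> \<rho> ` fm_vars \<phi> \<subseteq> {..<n} \<Longrightarrow>
    Sigma_rel V M \<alpha> n {as \<in> tuples M n. fm_sat M (\<lambda>i. as ! \<rho> i) \<phi>}"
  and Pi_in_imp_Sigma_rel:
  "Pi_in \<alpha> \<phi> \<Longrightarrow> fm_in V \<phi> \<Longrightarrow> \<rho> ` fm_vars \<phi> \<subseteq> {..<n} \<Longrightarrow>
    Sigma_rel V M \<alpha> n {as \<in> tuples M n. \<not> fm_sat M (\<lambda>i. as ! \<rho> i) \<phi>}"
proof (induction arbitrary: \<rho> n and \<rho> n rule: Sigma_in_Pi_in.inducts)
  case (Sigma_0 p)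
  then show ?case by (auto intro!: Sigma_rel_0 qf_definable_rename)
next
  case (Pi_0 p)
  then show ?case by (auto intro!: Sigma_rel_0 qf_definable_not qf_definable_rename)
next
  case (Sigma_step \<alpha> F X)
  let ?\<rho> = "\<lambda>m. extend_renaming \<rho> n (X m)"
  have vars: "\<rho> ` (fm_vars (F m) - set (X m)) \<subseteq> {..<n}" for m
    using Sigma_step.prems(2) by auto
  let ?R = "\<lambda>m. {as \<in> tuples M (n + length (X m)). \<not> fm_sat M (\<lambda>i. as ! ?\<rho> m i) (F m)}"
  have "Sigma_rel V M \<alpha> n {as \<in> tuples M n. \<exists>m. \<exists>bs\<in>tuples M (length (X m)). as @ bs \<notin> ?R m}"
  proof (rule Sigma_rel_step[OF \<open>0 < \<alpha>\<close>])
    fix m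
    have "fm_in V (F m)" using Sigma_step.prems(1) by simp
    with Sigma_step.IH[of m] extend_renaming_vars[OF vars]
    show "\<exists>\<beta><\<alpha>. Sigma_rel V M \<beta> (n + length (X m)) (?R m)" by blast
  qed
  moreover have "(\<exists>w\<in>reassign M (X m) (\<lambda>i. as ! \<rho> i). fm_sat M w (F m)) \<longleftrightarrow>
      (\<exists>bs\<in>tuples M (length (X m)). as @ bs \<notin> ?R m)" if as: "as \<in> tuples M n" for as m
  proof -
    have "(\<exists>w\<in>reassign M (X m) (\<lambda>i. as ! \<rho> i). fm_sat M w (F m)) \<longleftrightarrow>
        (\<exists>bs\<in>tuples M (length (X m)). fm_sat M (\<lambda>i. (as @ bs) ! ?\<rho> m i) (F m))"
      using vars[of m] by (intro reassign_iff_tuple[OF fm_sat_cong as]) auto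
    then show ?thesis using tuples_append[OF as] by blast
  qed
  then have "{as \<in> tuples M n. \<exists>m. \<exists>bs\<in>tuples M (length (X m)). as @ bs \<notin> ?R m} =
      {as \<in> tuples M n. fm_sat M (\<lambda>i. as ! \<rho> i) (OrEx X F)}"
    by (simp only: fm_sat.simps cong: conj_cong)
  ultimately show ?case by (simp only:)
next
  case (Pi_step \<alpha> F X)
  let ?\<rho> = "\<lambda>m. extend_renaming \<rho> n (X m)"
  have vars: "\<rho> ` (fm_vars (F m) - set (X m)) \<subseteq> {..<n}" for m
    using Pi_step.prems(2) by auto
  let ?R = "\<lambda>m. {as \<in> tuples M (n + length (X m)). fm_sat M (\<lambda>i. as ! ?\<rho> m i) (F m)}"
  have "Sigma_rel V M \<alpha> n {as \<in> tuples M n. \<exists>m. \<exists>bs\<in>tuples M (length (X m)). as @ bs \<notin> ?R m}"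
  proof (rule Sigma_rel_step[OF \<open>0 < \<alpha>\<close>])
    fix m
    have "fm_in V (F m)" using Pi_step.prems(1) by simp
    with Pi_step.IH[of m] extend_renaming_vars[OF vars]
    show "\<exists>\<beta><\<alpha>. Sigma_rel V M \<beta> (n + length (X m)) (?R m)" by blast
  qed
  moreover have "(\<exists>w\<in>reassign M (X m) (\<lambda>i. as ! \<rho> i). \<not> fm_sat M w (F m)) \<longleftrightarrow>
      (\<exists>bs\<in>tuples M (length (X m)). as @ bs \<notin> ?R m)" if as: "as \<in> tuples M n" for as m
  proof -
    have "(\<exists>w\<in>reassign M (X m) (\<lambda>i. as ! \<rho> i). \<not> fm_sat M w (F m)) \<longleftrightarrow>
        (\<exists>bs\<in>tuples M (length (X m)). \<not> fm_sat M (\<lambda>i. (as @ bs) ! ?\<rho> m i) (F m))"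
    proof (rule reassign_iff_tuple[OF _ as])
      show "(\<not> fm_sat M v (F m)) = (\<not> fm_sat M w (F m))"
        if "\<And>i. i \<in> fm_vars (F m) \<Longrightarrow> v i = w i" for v w
        using fm_sat_cong[of "F m" v w M] that by simp
    qed (use vars[of m] in auto)
    then show ?thesis using tuples_append[OF as] by blast
  qed
  then have "{as \<in> tuples M n. \<exists>m. \<exists>bs\<in>tuples M (length (X m)). as @ bs \<notin> ?R m} =
      {as \<in> tuples M n. \<not> fm_sat M (\<lambda>i. as ! \<rho> i) (AndAll X F)}"
    by (simp only: fm_sat.simps not_all bex_simps ball_simps cong: conj_cong)
  ultimately show ?case by (simp only:)
qed

text \<open>For the block \<open>[n..<n + k]\<close> the extended renaming is the identity on the
  relevant variables, so tuple positions can themselves serve as variables of the formulas built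
  next.\<close>

lemma reassign_upt_iff_tuple:
  assumes Q: "\<And>v w. (\<And>i. i < n + k \<Longrightarrow> v i = w i) \<Longrightarrow> Q v = Q w"
    and as: "as \<in> tuples M n"
  shows "(\<exists>w\<in>reassign M [n..<n + k] ((!) as). Q w) \<longleftrightarrow> (\<exists>bs\<in>tuples M k. Q ((!) (as @ bs)))"
proof -
  have ext: "extend_renaming (\<lambda>i. i) n [n..<n + k] i = i" if "i < n + k" for i
  proof (cases "n \<le> i")
    case True
    then have "i \<in> set [n..<n + k]" using that by simp
    then obtain j where "extend_renaming (\<lambda>i. i) n [n..<n + k] i = n + j"
      "j < length [n..<n + k]" "[n..<n + k] ! j = i" by (rule extend_renaming_in)
    then show ?thesis by simp
  qed (simp add: extend_renaming_def)
  have "(\<exists>w\<in>reassign M [n..<n + k] (\<lambda>i. as ! i). Q w) \<longleftrightarrow>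
    (\<exists>bs\<in>tuples M (length [n..<n + k]). Q (\<lambda>i. (as @ bs) ! extend_renaming (\<lambda>i. i) n [n..<n + k] i))"
  proof (rule reassign_iff_tuple[where B = "{..<n + k}", OF _ as])
    show "Q v = Q w" if "\<And>i. i \<in> {..<n + k} \<Longrightarrow> v i = w i" for v w
      using that by (intro Q) simp
  qed auto
  moreover have "Q (\<lambda>i. (as @ bs) ! extend_renaming (\<lambda>i. i) n [n..<n + k] i) = Q ((!) (as @ bs))" for bs
    by (rule Q) (simp add: ext)
  ultimately show ?thesis by simp
qed

text \<open>Each form feeds the other at the next step, so both are carried along: disjunctions are
  built from \<Pi> formulas for the complements of the \<open>R i\<close>, conjunctions from
  \<Sigma> formulas for the \<open>R i\<close> themselves.\<close>

lemma Sigma_rel_imp_formulas: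
  assumes "Sigma_rel V M \<alpha> n S"
  shows "(\<exists>\<phi>. Sigma_in \<alpha> \<phi> \<and> fm_in V \<phi> \<and> fm_vars \<phi> \<subseteq> {..<n} \<and>
      S = {as \<in> tuples M n. fm_sat M ((!) as) \<phi>}) \<and>
    (\<exists>\<phi>. Pi_in \<alpha> \<phi> \<and> fm_in V \<phi> \<and> fm_vars \<phi> \<subseteq> {..<n} \<and>
      S = {as \<in> tuples M n. \<not> fm_sat M ((!) as) \<phi>})"
  using assms
proof (induction rule: Sigma_rel.induct)
  case (Sigma_rel_0 n P)
  then obtain p where p: "qf_in V p" "qf_vars p \<subseteq> {..<n}" "\<forall>as\<in>tuples M n. qf_sat M ((!) as) p \<longleftrightarrow> P as"
    unfolding qf_definable_def by blast
  show ?case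
    using p by (intro conjI exI[of _ "QF p"] exI[of _ "QF (Neg p)"]) (auto intro: Sigma_0 Pi_0)
next
  case (Sigma_rel_step \<alpha> n k R)
  let ?S = "{as \<in> tuples M n. \<exists>i. \<exists>bs\<in>tuples M (k i). as @ bs \<notin> R i}"
  let ?X = "\<lambda>i. [n..<n + k i]"
  have "\<forall>i. \<exists>\<phi>. (\<exists>\<beta><\<alpha>. Pi_in \<beta> \<phi>) \<and> fm_in V \<phi> \<and> fm_vars \<phi> \<subseteq> {..<n + k i} \<and>
      R i = {as \<in> tuples M (n + k i). \<not> fm_sat M ((!) as) \<phi>}"
    using Sigma_rel_step.IH by blast
  from choice[OF this] obtain F where F':
      "\<forall>i. (\<exists>\<beta><\<alpha>. Pi_in \<beta> (F i)) \<and> fm_in V (F i) \<and> fm_vars (F i) \<subseteq> {..<n + k i} \<and>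
        R i = {as \<in> tuples M (n + k i). \<not> fm_sat M ((!) as) (F i)}" ..
  have F: "\<exists>\<beta><\<alpha>. Pi_in \<beta> (F i)" "fm_in V (F i)" "fm_vars (F i) \<subseteq> {..<n + k i}"
      "R i = {as \<in> tuples M (n + k i). \<not> fm_sat M ((!) as) (F i)}" for i
    using F'[rule_format, of i] by blast+
  have "\<forall>i. \<exists>\<phi>. (\<exists>\<beta><\<alpha>. Sigma_in \<beta> \<phi>) \<and> fm_in V \<phi> \<and> fm_vars \<phi> \<subseteq> {..<n + k i} \<and>
      R i = {as \<in> tuples M (n + k i). fm_sat M ((!) as) \<phi>}"
    using Sigma_rel_step.IH by blast
  from choice[OF this] obtain G where G':
      "\<forall>i. (\<exists>\<beta><\<alpha>. Sigma_in \<beta> (G i)) \<and> fm_in V (G i) \<and> fm_vars (G i) \<subseteq> {..<n + k i} \<and>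
        R i = {as \<in> tuples M (n + k i). fm_sat M ((!) as) (G i)}" ..
  have G: "\<exists>\<beta><\<alpha>. Sigma_in \<beta> (G i)" "fm_in V (G i)" "fm_vars (G i) \<subseteq> {..<n + k i}"
      "R i = {as \<in> tuples M (n + k i). fm_sat M ((!) as) (G i)}" for i
    using G'[rule_format, of i] by blast+
  have "fm_vars (OrEx ?X F) \<subseteq> {..<n}" "fm_vars (AndAll ?X G) \<subseteq> {..<n}"
    using F(3) G(3) by (fastforce simp: subset_iff)+
  moreover have "?S = {as \<in> tuples M n. fm_sat M ((!) as) (OrEx ?X F)}"
  proof -
    have "(\<exists>w\<in>reassign M (?X i) ((!) as). fm_sat M w (F i)) \<longleftrightarrow> (\<exists>bs\<in>tuples M (k i). as @ bs \<notin> R i)"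
      if as: "as \<in> tuples M n" for as i
    proof -
      have "(\<exists>w\<in>reassign M (?X i) ((!) as). fm_sat M w (F i)) \<longleftrightarrow>
          (\<exists>bs\<in>tuples M (k i). fm_sat M ((!) (as @ bs)) (F i))"
      proof (rule reassign_upt_iff_tuple[OF _ as])
        show "fm_sat M v (F i) = fm_sat M w (F i)" if "\<And>j. j < n + k i \<Longrightarrow> v j = w j" for v w
          by (rule fm_sat_cong) (use that F(3)[of i] in auto)
      qed
      then show ?thesis using F(4) tuples_append[OF as] by blast
    qed
    then show ?thesis by (simp only: fm_sat.simps cong: conj_cong)
  qed
  moreover have "?S = {as \<in> tuples M n. \<not> fm_sat M ((!) as) (AndAll ?X G)}"
  proof -
    have "(\<exists>w\<in>reassign M (?X i) ((!) as). \<not> fm_sat M w (G i)) \<longleftrightarrow> (\<exists>bs\<in>tuples M (k i). as @ bs \<notin> R i)"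
      if as: "as \<in> tuples M n" for as i
    proof -
      have "(\<exists>w\<in>reassign M (?X i) ((!) as). \<not> fm_sat M w (G i)) \<longleftrightarrow>
          (\<exists>bs\<in>tuples M (k i). \<not> fm_sat M ((!) (as @ bs)) (G i))"
      proof (rule reassign_upt_iff_tuple[OF _ as])
        show "(\<not> fm_sat M v (G i)) = (\<not> fm_sat M w (G i))" if "\<And>j. j < n + k i \<Longrightarrow> v j = w j" for v w
        proof -
          have "fm_sat M v (G i) = fm_sat M w (G i)"
            by (rule fm_sat_cong) (use that G(3)[of i] in auto)
          then show ?thesis by simp
        qed
      qed
      then show ?thesis using G(4) tuples_append[OF as] by blast
    qed
    then show ?thesis by (simp only: fm_sat.simps not_all bex_simps ball_simps cong: conj_cong)
  qed
  moreover have "Sigma_in \<alpha> (OrEx ?X F)" "Pi_in \<alpha> (AndAll ?X G)"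
    by (rule Sigma_step[OF \<open>0 < \<alpha>\<close>], rule F(1), rule Pi_step[OF \<open>0 < \<alpha>\<close>], rule G(1))
  moreover have "fm_in V (OrEx ?X F)" "fm_in V (AndAll ?X G)" using F(2) G(2) by simp_all
  ultimately show ?case by blast
qed

lemma Sigma_definable_iff: "Sigma_definable V M \<alpha> n S \<longleftrightarrow> Sigma_rel V M \<alpha> n S"
proof
  assume "Sigma_definable V M \<alpha> n S"
  then obtain \<phi> where "Sigma_in \<alpha> \<phi>" "fm_in V \<phi>" "fm_vars \<phi> \<subseteq> {..<n}"
    and S: "S = {as \<in> tuples M n. fm_sat M ((!) as) \<phi>}"
    unfolding Sigma_definable_def by blast
  then show "Sigma_rel V M \<alpha> n S"
    using Sigma_in_imp_Sigma_rel[of \<alpha> \<phi> V "\<lambda>i. i" n M] by simp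
next
  assume "Sigma_rel V M \<alpha> n S"
  then show "Sigma_definable V M \<alpha> n S"
    unfolding Sigma_definable_def using Sigma_rel_imp_formulas by blast
qed

section \<open>Automorphisms and back-and-forth systems\<close>

lemma tm_val_in_univ:
  assumes "is_model V M" "tm_in V t" "v ` tm_vars t \<subseteq> univ M"
  shows "tm_val M v t \<in> univ M"
  using assms(2,3)
proof (induction t)
  case (App f ts)
  then have "map (tm_val M v) ts \<in> tuples M (fun_arity V f)"
    by (force simp: tuples_def list_all_iff)
  then show ?case using App.prems assms(1) by (simp add: is_model_def)
qed auto

lemma automorphism_tm_val:
  assumes "is_model V M" "automorphism V M g" "tm_in V t" "v ` tm_vars t \<subseteq> univ M"
  shows "tm_val M (\<lambda>i. g (v i)) t = g (tm_val M v t)"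
  using assms(3,4)
proof (induction t)
  case (App f ts)
  have ts: "tm_val M v t \<in> univ M" "tm_val M (\<lambda>i. g (v i)) t = g (tm_val M v t)" if "t \<in> set ts" for t
    using that App tm_val_in_univ[OF assms(1), of t v] by (force simp: list_all_iff)+
  then have "map (tm_val M v) ts \<in> tuples M (fun_arity V f)"
    using App.prems by (auto simp: tuples_def)
  then have "g (fun_int M f (map (tm_val M v) ts)) = fun_int M f (map g (map (tm_val M v) ts))"
    using App.prems assms(2) by (simp add: automorphism_def)
  also have "map g (map (tm_val M v) ts) = map (tm_val M (\<lambda>i. g (v i))) ts" using ts by simp
  finally show ?case by simp
qed simp

lemma automorphism_atom_sat:
  assumes "is_model V M" "automorphism V M g" "atom_in V a" "v ` atom_vars a \<subseteq> univ M"
  shows "atom_sat M (\<lambda>i. g (v i)) a \<longleftrightarrow> atom_sat M v a"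
proof (cases a)
  case (Eq s t)
  have "tm_val M (\<lambda>i. g (v i)) s = g (tm_val M v s)" "tm_val M (\<lambda>i. g (v i)) t = g (tm_val M v t)"
    "tm_val M v s \<in> univ M" "tm_val M v t \<in> univ M"
    using assms Eq by (auto intro!: automorphism_tm_val tm_val_in_univ)
  moreover have "inj_on g (univ M)" using assms(2) by (simp add: automorphism_def bij_betw_def)
  ultimately show ?thesis using Eq by (simp add: inj_on_eq_iff)
next
  case (Rel r ts)
  have "tm_val M v t \<in> univ M" "tm_val M (\<lambda>i. g (v i)) t = g (tm_val M v t)" if "t \<in> set ts" for t
    using that assms Rel by (force intro!: automorphism_tm_val tm_val_in_univ)+
  then have "map (tm_val M (\<lambda>i. g (v i))) ts = map g (map (tm_val M v) ts)"
    "map (tm_val M v) ts \<in> tuples M (rel_arity V r)"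
    using Rel assms(3) by (auto simp: tuples_def)
  then show ?thesis using assms(2,3) Rel unfolding automorphism_def by (auto simp del: map_map)
qed

lemma automorphism_inv_into:
  assumes "is_model V M" "automorphism V M g"
  shows "automorphism V M (inv_into (univ M) g)"
proof -
  let ?h = "inv_into (univ M) g"
  have bij: "bij_betw g (univ M) (univ M)" using assms(2) by (simp add: automorphism_def)
  have hg: "?h (g a) = a" if "a \<in> univ M" for a using bij that by (rule bij_betw_inv_into_left)
  have gh: "g (?h a) = a" if "a \<in> univ M" for a using bij that by (rule bij_betw_inv_into_right)
  have h: "?h a \<in> univ M" if "a \<in> univ M" for a
    using bij_betw_inv_into[OF bij] that by (auto simp: bij_betw_def)
  have map_h: "map ?h as \<in> tuples M n" "map g (map ?h as) = as" if "as \<in> tuples M n" for as n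
    using that h gh by (auto simp: tuples_def in_lists_conv_set intro!: map_idI)
  show ?thesis
    unfolding automorphism_def
  proof (intro conjI ballI)
    show "bij_betw ?h (univ M) (univ M)" using bij by (rule bij_betw_inv_into)
    fix f as assume f: "f \<in> Funs V" "as \<in> tuples M (fun_arity V f)"
    have "g (fun_int M f (map ?h as)) = fun_int M f (map g (map ?h as))"
      using assms(2) f map_h(1) unfolding automorphism_def by blast
    then have "g (fun_int M f (map ?h as)) = fun_int M f as" using map_h(2) f by metis
    moreover have "fun_int M f (map ?h as) \<in> univ M"
      using assms(1) f map_h(1) unfolding is_model_def by blast
    ultimately show "?h (fun_int M f as) = fun_int M f (map ?h as)" using hg by metis
  next
    fix r as assume r: "r \<in> Rels V" "as \<in> tuples M (rel_arity V r)"
    have "rel_int M r (map g (map ?h as)) = rel_int M r (map ?h as)"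
      using assms(2) r map_h(1) unfolding automorphism_def by blast
    then show "rel_int M r (map ?h as) = rel_int M r as" using map_h(2) r by metis
  qed
qed

lemma automorphism_in_univ: "automorphism V M g \<Longrightarrow> a \<in> univ M \<Longrightarrow> g a \<in> univ M"
  by (auto simp: automorphism_def bij_betw_def)

lemma automorphism_map_tuples:
  "automorphism V M g \<Longrightarrow> as \<in> tuples M n \<Longrightarrow> map g as \<in> tuples M n"
  by (auto simp: tuples_def automorphism_in_univ)

lemma orbit_sym:
  assumes "is_model V M" "as \<in> lists (univ M)" "bs \<in> orbit V M as"
  shows "as \<in> orbit V M bs"
proof -
  obtain g where g: "automorphism V M g" "bs = map g as" using assms(3) by (auto simp: orbit_def)
  have "map (inv_into (univ M) g) bs = as"
    using assms(2) g by (auto simp: automorphism_def in_lists_conv_set bij_betw_inv_into_left intro!: map_idI)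
  then show ?thesis using automorphism_inv_into[OF assms(1) g(1)] by (auto simp: orbit_def)
qed

lemma orbit_take: "bs \<in> orbit V M as \<Longrightarrow> take k bs \<in> orbit V M (take k as)"
  by (auto simp: orbit_def take_map)

lemma orbit_subset: "as \<in> tuples M n \<Longrightarrow> orbit V M as \<subseteq> tuples M n"
  by (auto simp: orbit_def intro: automorphism_map_tuples)

text \<open>Agreement on an atom is demanded only of sequences past a threshold depending on the
  atom. Since the sequences grow without bound, every atom is settled eventually; this tolerates
  labels that reveal atoms late. The criterion is applied both to A and to the tree.\<close>

lemma back_and_forth:
  fixes M :: "('a, 'f, 'r) model"
  assumes model: "is_model V M" and count: "countable (univ M)"
    and P0: "P zs\<^sub>0" and P_univ: "\<And>zs. P zs \<Longrightarrow> set zs \<subseteq> univ M \<times> univ M"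
    and forth_step: "\<And>zs a. P zs \<Longrightarrow> a \<in> univ M \<Longrightarrow> \<exists>b. P (zs @ [(a, b)])"
    and back_step: "\<And>zs b. P zs \<Longrightarrow> b \<in> univ M \<Longrightarrow> \<exists>a. P (zs @ [(a, b)])"
    and atoms: "\<And>a. atom_in V a \<Longrightarrow> \<exists>N. \<forall>zs. P zs \<longrightarrow> N \<le> length zs \<longrightarrow> atom_vars a \<subseteq> {..<length zs} \<longrightarrow>
      (atom_sat M ((!) (map fst zs)) a \<longleftrightarrow> atom_sat M ((!) (map snd zs)) a)"
  shows "\<exists>g. automorphism V M g \<and> map g (map fst zs\<^sub>0) = map snd zs\<^sub>0"
proof -
  define c where "c = from_nat_into (univ M)"
  have range_c: "range c = univ M"
    unfolding c_def using model count by (intro range_from_nat_into) (auto simp: is_model_def)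
  \<comment> \<open>Two pairs are appended even if \<open>c n\<close> already occurs, so the length
    passes every threshold. Repetitions are harmless because equality is one of the atoms.\<close>
  have step: "\<exists>zs'. P zs' \<and> strict_prefix zs zs' \<and> c n \<in> fst ` set zs' \<and> c n \<in> snd ` set zs'"
    if zs: "P zs" for zs n
  proof -
    have cn: "c n \<in> univ M" using range_c by blast
    obtain b where b: "P (zs @ [(c n, b)])" using forth_step[OF zs cn] by blast
    obtain a where "P ((zs @ [(c n, b)]) @ [(a, c n)])" using back_step[OF b cn] by blast
    then show ?thesis by (intro exI[of _ "(zs @ [(c n, b)]) @ [(a, c n)]"])
        (auto simp: strict_prefix_def)
  qed
  \<comment> \<open>The clause for \<open>n = 0\<close> pins the start, so that the automorphism
    extends \<open>zs\<^sub>0\<close>.\<close>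
  obtain Z where Z: "\<And>n. P (Z n)" "Z 0 = zs\<^sub>0"
    and Z_step: "\<And>n. strict_prefix (Z n) (Z (Suc n)) \<and> c n \<in> fst ` set (Z (Suc n)) \<and> c n \<in> snd ` set (Z (Suc n))"
    using dependent_nat_choice[of "\<lambda>n zs. P zs \<and> (n = 0 \<longrightarrow> zs = zs\<^sub>0)"
        "\<lambda>n zs zs'. strict_prefix zs zs' \<and> c n \<in> fst ` set zs' \<and> c n \<in> snd ` set zs'"] P0 step
    by (metis nat.distinct(1))
  have Z_prefix: "prefix (Z m) (Z n)" if "m \<le> n" for m n
    using that
  proof (induction rule: dec_induct)
    case (step n)
    then show ?case using Z_step[of n] prefix_order.less_imp_le prefix_order.trans by blast
  qed simp
  have Z_length: "n \<le> length (Z n)" for n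
  proof (induction n)
    case (Suc n)
    have "length (Z n) < length (Z (Suc n))" using Z_step[of n] prefix_length_less by blast
    then show ?case using Suc by simp
  qed simp
  define G where "G = (\<Union>n. set (Z n))"
  \<comment> \<open>Pairs collected at different stages lie in a common stage; the atom is renamed
    to their positions there, and a later stage passes the threshold of the renamed atom.\<close>
  have transfer: "atom_sat M ((!) (map fst ps)) a \<longleftrightarrow> atom_sat M ((!) (map snd ps)) a"
    if ps: "set ps \<subseteq> G" and a: "atom_in V a" "atom_vars a \<subseteq> {..<length ps}" for ps a
  proof -
    have "\<exists>n. set ps \<subseteq> set (Z n)" using ps
    proof (induction ps)
      case (Cons p ps)
      then obtain m n where "set ps \<subseteq> set (Z m)" "p \<in> set (Z n)" by (auto simp: G_def)
      then have "set (p # ps) \<subseteq> set (Z (max m n))"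
        using set_mono_prefix[OF Z_prefix[of m "max m n"]] set_mono_prefix[OF Z_prefix[of n "max m n"]]
        by auto
      then show ?case by blast
    qed simp
    then obtain n where n: "set ps \<subseteq> set (Z n)" ..
    have "\<forall>i. \<exists>j. i < length ps \<longrightarrow> j < length (Z n) \<and> Z n ! j = ps ! i"
      using n by (metis in_set_conv_nth nth_mem subset_iff)
    from choice[OF this] obtain \<rho> where \<rho>: "\<forall>i. i < length ps \<longrightarrow> \<rho> i < length (Z n) \<and> Z n ! \<rho> i = ps ! i" ..
    obtain N where N: "\<forall>zs. P zs \<longrightarrow> N \<le> length zs \<longrightarrow> atom_vars (atom_rename \<rho> a) \<subseteq> {..<length zs} \<longrightarrow>
        (atom_sat M ((!) (map fst zs)) (atom_rename \<rho> a) \<longleftrightarrow> atom_sat M ((!) (map snd zs)) (atom_rename \<rho> a))"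
      using atoms[of "atom_rename \<rho> a"] a(1) by (auto simp: atom_in_rename)
    let ?Z = "Z (max n N)"
    obtain zs where zs: "?Z = Z n @ zs" using Z_prefix[of n "max n N"] by (auto simp: prefix_def)
    have Z\<rho>: "\<rho> i < length ?Z \<and> ?Z ! \<rho> i = ps ! i" if "i \<in> atom_vars a" for i
      using \<rho> a(2) that by (auto simp: zs nth_append subset_iff)
    have "N \<le> length ?Z" using Z_length[of "max n N"] by simp
    moreover have "atom_vars (atom_rename \<rho> a) \<subseteq> {..<length ?Z}"
      using Z\<rho> by (auto simp: atom_vars_rename)
    ultimately have "atom_sat M ((!) (map fst ?Z)) (atom_rename \<rho> a) \<longleftrightarrow>
        atom_sat M ((!) (map snd ?Z)) (atom_rename \<rho> a)"
      using N Z(1) by blast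
    moreover have "atom_sat M ((!) (map h ?Z)) (atom_rename \<rho> a) \<longleftrightarrow> atom_sat M ((!) (map h ps)) a"
      for h :: "'a \<times> 'a \<Rightarrow> 'a"
      unfolding atom_sat_rename using Z\<rho> a(2) by (intro atom_sat_cong) auto
    ultimately show ?thesis by simp
  qed
  \<comment> \<open>The equality atom makes the union of the stages single-valued and injective at
    once.\<close>
  have eq_iff: "a = a' \<longleftrightarrow> b = b'" if "(a, b) \<in> G" "(a', b') \<in> G" for a b a' b'
    using transfer[of "[(a, b), (a', b')]" "Eq (Var 0) (Var 1)"] that by simp
  have G_univ: "a \<in> univ M" "b \<in> univ M" if "(a, b) \<in> G" for a b
  proof -
    obtain n where "(a, b) \<in> set (Z n)" using \<open>(a, b) \<in> G\<close> by (auto simp: G_def)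
    then show "a \<in> univ M" "b \<in> univ M" using P_univ[OF Z(1)[of n]] by auto
  qed
  have total: "\<exists>b. (a, b) \<in> G" "\<exists>b. (b, a) \<in> G" if a: "a \<in> univ M" for a
  proof -
    obtain n where "a = c n" using a range_c by blast
    then have "a \<in> fst ` set (Z (Suc n))" "a \<in> snd ` set (Z (Suc n))" using Z_step[of n] by auto
    then show "\<exists>b. (a, b) \<in> G" "\<exists>b. (b, a) \<in> G" by (force simp: G_def)+
  qed
  define g where "g = (\<lambda>a. SOME b. (a, b) \<in> G)"
  have g: "(a, g a) \<in> G" if "a \<in> univ M" for a
    unfolding g_def using total(1)[OF that] by (rule someI_ex)
  have G_g: "g a = b" if "(a, b) \<in> G" for a b
    using eq_iff[OF that g[OF G_univ(1)[OF that]]] by simp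
  have "automorphism V M g"
    unfolding automorphism_def
  proof (intro conjI ballI)
    show "bij_betw g (univ M) (univ M)"
      unfolding bij_betw_def
    proof
      show "inj_on g (univ M)" using eq_iff g by (blast intro: inj_onI)
      show "g ` univ M = univ M"
      proof (intro equalityI subsetI)
        fix b assume "b \<in> g ` univ M"
        then show "b \<in> univ M" using G_univ(2)[OF g] by auto
      next
        fix b assume "b \<in> univ M"
        then obtain a where "(a, b) \<in> G" using total(2) by blast
        then show "b \<in> g ` univ M" using G_g[of a b] G_univ(1)[of a b] by blast
      qed
    qed
    fix f as assume f: "f \<in> Funs V" "as \<in> tuples M (fun_arity V f)"
    let ?y = "fun_int M f as"
    \<comment> \<open>Preservation of \<open>f\<close> is read off the atom saying that entry 0 is
      \<open>f\<close> of the remaining entries.\<close>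
    let ?ps = "(?y, g ?y) # map (\<lambda>x. (x, g x)) as"
    have y: "?y \<in> univ M" using f model by (simp add: is_model_def)
    have "set ?ps \<subseteq> G" using g[OF y] g f(2) by (auto simp: tuples_def)
    moreover have "atom_in V (Eq (Var 0) (App f (map (\<lambda>i. Var (Suc i)) [0..<length as])))"
      using f by (auto simp: tuples_def list_all_iff)
    ultimately have "atom_sat M ((!) (map fst ?ps)) (Eq (Var 0) (App f (map (\<lambda>i. Var (Suc i)) [0..<length as]))) \<longleftrightarrow>
        atom_sat M ((!) (map snd ?ps)) (Eq (Var 0) (App f (map (\<lambda>i. Var (Suc i)) [0..<length as])))"
      by (rule transfer) auto
    moreover have *: "map (tm_val M ((!) (x # xs))) (map (\<lambda>i. Var (Suc i)) [0..<length xs]) = xs"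
      for x and xs :: "'a list"
      by (rule nth_equalityI) auto
    have "map fst ?ps = ?y # as" "map snd ?ps = g ?y # map g as" by (simp_all add: o_def)
    then have "map (tm_val M ((!) (map fst ?ps))) (map (\<lambda>i. Var (Suc i)) [0..<length as]) = as"
      "map (tm_val M ((!) (map snd ?ps))) (map (\<lambda>i. Var (Suc i)) [0..<length as]) = map g as"
      using *[of ?y as] *[of "g ?y" "map g as"] by (simp_all only: length_map)
    ultimately show "g ?y = fun_int M f (map g as)" by (simp del: map_map)
  next
    fix r as assume r: "r \<in> Rels V" "as \<in> tuples M (rel_arity V r)"
    let ?ps = "map (\<lambda>x. (x, g x)) as"
    have "set ?ps \<subseteq> G" using g r(2) by (auto simp: tuples_def)
    moreover have "atom_in V (Rel r (map Var [0..<length as]))"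
      using r by (auto simp: tuples_def)
    ultimately have "atom_sat M ((!) (map fst ?ps)) (Rel r (map Var [0..<length as])) \<longleftrightarrow>
        atom_sat M ((!) (map snd ?ps)) (Rel r (map Var [0..<length as]))"
      by (rule transfer) auto
    moreover have *: "map (tm_val M ((!) xs)) (map Var [0..<length xs]) = xs" for xs :: "'a list"
      by (rule nth_equalityI) auto
    have "map fst ?ps = as" "map snd ?ps = map g as" by (simp_all add: o_def)
    then have "map (tm_val M ((!) (map fst ?ps))) (map Var [0..<length as]) = as"
      "map (tm_val M ((!) (map snd ?ps))) (map Var [0..<length as]) = map g as"
      using *[of as] *[of "map g as"] by (simp_all only: length_map)
    ultimately show "rel_int M r (map g as) \<longleftrightarrow> rel_int M r as" by (simp del: map_map)
  qed
  moreover have "map g (map fst zs\<^sub>0) = map snd zs\<^sub>0"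
  proof -
    have "g (fst z) = snd z" if "z \<in> set zs\<^sub>0" for z
      using that Z(2) by (intro G_g) (force simp: G_def)
    then show ?thesis by simp
  qed
  ultimately show ?thesis by blast
qed

section \<open>Automorphisms of the tree of tuples\<close>

lemma orbit_Nil: "[] \<in> orbit V M []"
proof -
  have "automorphism V M (\<lambda>a. a)" by (auto simp: automorphism_def bij_betw_def)
  then show ?thesis by (auto simp: orbit_def)
qed

lemma orbit_length: "bs \<in> orbit V M as \<Longrightarrow> length bs = length as"
  by (auto simp: orbit_def)

section \<open>Labels, terms and atoms of the tree\<close>

lemma tuple_label_eq_iff:
  "tuple_label e A as = tuple_label e A bs \<longleftrightarrow>
    length as = length bs \<and> finite_diagram e A as = finite_diagram e A bs"
  by (auto simp: tuple_label_def)

lemma finite_diagram_nth: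
  "i < length as \<Longrightarrow> finite_diagram e A as ! i \<longleftrightarrow>
    atom_vars (e i) \<subseteq> {..<length as} \<and> atom_sat A ((!) as) (e i)"
  by (simp add: finite_diagram_def)

lemma length_finite_diagram: "length (finite_diagram e A as) = length as"
  by (simp add: finite_diagram_def)

text \<open>A term is an iterated \<open>Parent\<close> of one variable. The root being its own
  parent matches truncated subtraction.\<close>

lemma tm_val_tree:
  assumes "tm_in tree_vocabulary t"
  obtains i j where "tm_vars t = {i}"
    "\<And>v. tm_val (tree_of_tuples e A) v t = take (length (v i) - j) (v i)"
proof -
  have "\<exists>i j. tm_vars t = {i} \<and>
      (\<forall>v. tm_val (tree_of_tuples e A) v t = take (length (v i) - j) (v i))"
    using assms
  proof (induction t)
    case (Var i)
    show ?case by (intro exI[of _ i] exI[of _ 0]) simp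
  next
    case (App f ts)
    then obtain t where t: "ts = [t]" "tm_in tree_vocabulary t"
      by (auto simp: tree_vocabulary_def length_Suc_conv)
    then obtain i j where "tm_vars t = {i}"
      "\<forall>v. tm_val (tree_of_tuples e A) v t = take (length (v i) - j) (v i)"
      using App.IH[of t] by auto
    then show ?case
      using t(1) by (intro exI[of _ i] exI[of _ "Suc j"])
        (auto simp: tree_of_tuples_def replicated_tree_def labelled_tree_def butlast_take)
  qed
  then show ?thesis using that by blast
qed

lemma rel_int_tree:
  "rel_int (tree_of_tuples e A) Below [\<sigma>, \<tau>] \<longleftrightarrow> prefix \<sigma> \<tau>"
  "rel_int (tree_of_tuples e A) (Label n) [\<sigma>] \<longleftrightarrow> tuple_label e A (map fst \<sigma>) = n"
  by (auto simp: tree_of_tuples_def replicated_tree_def labelled_tree_def)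

lemma atom_in_treeE:
  assumes "atom_in tree_vocabulary a"
  obtains s t where "a = Eq s t" "tm_in tree_vocabulary s" "tm_in tree_vocabulary t"
  | s t where "a = Rel Below [s, t]" "tm_in tree_vocabulary s" "tm_in tree_vocabulary t"
  | n t where "a = Rel (Label n) [t]" "tm_in tree_vocabulary t"
proof (cases a)
  case (Eq s t)
  then show ?thesis using assms that(1) by simp
next
  case (Rel r ts)
  show ?thesis
  proof (cases r)
    case Below
    then have "length ts = 2" using assms Rel by (simp add: tree_vocabulary_def)
    then obtain s t where "ts = [s, t]" by (auto simp: numeral_2_eq_2 length_Suc_conv)
    then show ?thesis using assms that(2) Rel Below by simp
  next
    case (Label n)
    then have "length ts = 1" using assms Rel by (simp add: tree_vocabulary_def)
    then obtain t where "ts = [t]" by (auto simp: length_Suc_conv)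
    then show ?thesis using assms that(3) Rel Label by simp
  qed
qed

text \<open>Reduces comparing ancestors at two depths to one common depth, the only comparison that
  \<open>tree_sim\<close> records.\<close>

lemma take_eq_take_iff:
  assumes "k \<le> length xs" "l \<le> length ys"
  shows "take k xs = take l ys \<longleftrightarrow> k = l \<and> take k xs = take k ys"
  using assms by (metis length_take min.absorb2)

lemma prefix_take_take_iff:
  assumes "k \<le> length xs" "l \<le> length ys"
  shows "prefix (take k xs) (take l ys) \<longleftrightarrow> k \<le> l \<and> take k xs = take k ys"
proof
  assume p: "prefix (take k xs) (take l ys)"
  then have "k \<le> l" using prefix_length_le[OF p] assms by simp
  then show "k \<le> l \<and> take k xs = take k ys"
    using p assms by (auto simp: prefix_def) (metis append_eq_conv_conj length_take min.absorb2 take_take)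
next
  assume "k \<le> l \<and> take k xs = take k ys"
  then show "prefix (take k xs) (take l ys)"
    by (metis min.absorb1 take_is_prefix take_take)
qed

locale tuple_tree =
  fixes V :: "('f, 'r) vocabulary" and A :: "('a, 'f, 'r) model" and e :: "nat \<Rightarrow> ('f, 'r) atom"
  assumes model: "is_model V A" and countable_univ: "countable (univ A)"
    and enum: "enumerates_atoms V e"
begin

abbreviation T :: "(('a \<times> nat) list, tree_fun, tree_rel) model"
  where "T \<equiv> tree_of_tuples e A"

lemma atom_in_enum: "atom_in V a \<Longrightarrow> \<exists>j. e j = a"
proof -
  assume "atom_in V a"
  then have "a \<in> range e" using enum by (simp add: enumerates_atoms_def)
  then show ?thesis by blast
qed

lemma in_univ_T: "\<sigma> \<in> univ T \<longleftrightarrow> map fst \<sigma> \<in> lists (univ A)"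
  by (simp add: tree_of_tuples_def replicated_tree_def labelled_tree_def)

lemma take_in_univ_T: "\<sigma> \<in> univ T \<Longrightarrow> take k \<sigma> \<in> univ T"
  by (force simp: in_univ_T dest: in_set_takeD)

lemma is_model_T: "is_model tree_vocabulary T"
proof -
  have "[] \<in> univ T" by (simp add: in_univ_T)
  moreover have "fun_int T f \<sigma>s \<in> univ T" if \<sigma>s: "\<sigma>s \<in> tuples T 1" for f \<sigma>s
  proof -
    obtain \<sigma> where "\<sigma>s = [\<sigma>]" "\<sigma> \<in> univ T" using \<sigma>s by (auto simp: tuples_def length_Suc_conv)
    then show ?thesis
      using take_in_univ_T[of \<sigma>]
      by (simp add: tree_of_tuples_def replicated_tree_def labelled_tree_def butlast_conv_take)
  qed
  ultimately show ?thesis by (auto simp: is_model_def tree_vocabulary_def)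
qed

lemma countable_univ_T: "countable (univ T)"
proof -
  have "univ T \<subseteq> lists (univ A \<times> UNIV)" by (force simp: in_univ_T)
  moreover have "countable (lists (univ A \<times> (UNIV :: nat set)))"
    using countable_univ by (intro countable_lists countable_SIGMA) auto
  ultimately show ?thesis by (rule countable_subset)
qed

lemma tuple_label_orbit:
  assumes "as \<in> lists (univ A)" "bs \<in> orbit V A as"
  shows "tuple_label e A bs = tuple_label e A as"
proof -
  obtain g where g: "automorphism V A g" "bs = map g as" using assms(2) by (auto simp: orbit_def)
  have "atom_sat A ((!) (map g as)) (e i) \<longleftrightarrow> atom_sat A ((!) as) (e i)"
    if "atom_vars (e i) \<subseteq> {..<length as}" for i
  proof -
    have "atom_sat A ((!) (map g as)) (e i) \<longleftrightarrow> atom_sat A (\<lambda>j. g (as ! j)) (e i)"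
      using that by (intro atom_sat_cong) auto
    also have "\<dots> \<longleftrightarrow> atom_sat A ((!) as) (e i)"
      using that assms(1) enum
      by (intro automorphism_atom_sat[OF model g(1)]) (auto simp: enumerates_atoms_def)
    finally show ?thesis .
  qed
  then have "finite_diagram e A bs = finite_diagram e A as"
    unfolding finite_diagram_def g(2) by auto
  then show ?thesis using g(2) by (simp add: tuple_label_eq_iff)
qed

section \<open>Tree automorphisms acting on the underlying tuples\<close>

context
  fixes h
  assumes h: "automorphism tree_vocabulary T h"
begin

lemma tree_automorphism_label:
  assumes "\<sigma> \<in> univ T"
  shows "tuple_label e A (map fst (h \<sigma>)) = tuple_label e A (map fst \<sigma>)"
proof -
  have "[\<sigma>] \<in> tuples T (rel_arity tree_vocabulary (Label n))" for n
    using assms by (simp add: tuples_def tree_vocabulary_def)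
  moreover have "Label n \<in> Rels tree_vocabulary" for n by (simp add: tree_vocabulary_def)
  ultimately have "rel_int T (Label n) (map h [\<sigma>]) \<longleftrightarrow> rel_int T (Label n) [\<sigma>]" for n
    using h unfolding automorphism_def by blast
  then show ?thesis by (simp add: rel_int_tree)
qed

lemma tree_automorphism_length: "\<sigma> \<in> univ T \<Longrightarrow> length (h \<sigma>) = length \<sigma>"
  using tree_automorphism_label by (metis length_map tuple_label_eq_iff)

lemma tree_automorphism_butlast:
  assumes "\<sigma> \<in> univ T"
  shows "h (butlast \<sigma>) = butlast (h \<sigma>)"
proof -
  have "[\<sigma>] \<in> tuples T (fun_arity tree_vocabulary Parent)"
    using assms by (simp add: tuples_def tree_vocabulary_def)
  moreover have "Parent \<in> Funs tree_vocabulary" by (simp add: tree_vocabulary_def)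
  ultimately have "h (fun_int T Parent [\<sigma>]) = fun_int T Parent (map h [\<sigma>])"
    using h unfolding automorphism_def by blast
  then show ?thesis by (simp add: tree_of_tuples_def replicated_tree_def labelled_tree_def)
qed

lemma tree_automorphism_take: "\<sigma> \<in> univ T \<Longrightarrow> h (take k \<sigma>) = take k (h \<sigma>)"
proof (induction \<sigma> rule: rev_induct)
  case Nil
  then show ?case using tree_automorphism_length[of "[]"] by simp
next
  case (snoc x \<sigma>)
  have len: "length (h (\<sigma> @ [x])) = Suc (length \<sigma>)" using tree_automorphism_length[OF snoc.prems] by simp
  show ?case
  proof (cases "k \<le> length \<sigma>")
    case True
    have "\<sigma> \<in> univ T" using snoc.prems by (simp add: in_univ_T)
    then have "h (take k \<sigma>) = take k (h \<sigma>)" by (rule snoc.IH)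
    moreover have "h \<sigma> = butlast (h (\<sigma> @ [x]))" using tree_automorphism_butlast[OF snoc.prems] by simp
    ultimately show ?thesis using True len by (simp add: butlast_conv_take min_def)
  next
    case False
    then show ?thesis using len by simp
  qed
qed

text \<open>The pairs of tuples lying below a node and its image form a back-and-forth system: at every
  level the labels agree on longer and longer initial segments of the atomic diagram.\<close>

lemma tree_automorphism_orbit:
  assumes "\<sigma> \<in> univ T"
  shows "map fst (h \<sigma>) \<in> orbit V A (map fst \<sigma>)"
proof -
  have bij: "bij_betw h (univ T) (univ T)" using h by (simp add: automorphism_def)
  have h_univ: "h \<sigma> \<in> univ T" if "\<sigma> \<in> univ T" for \<sigma> using h that by (rule automorphism_in_univ)
  \<comment> \<open>The node only witnesses the sequence of pairs; its copy numbers are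
    forgotten.\<close>
  let ?P = "\<lambda>zs. \<exists>\<sigma>\<in>univ T. map fst \<sigma> = map fst zs \<and> map fst (h \<sigma>) = map snd zs"
  have "\<exists>g. automorphism V A g \<and>
      map g (map fst (zip (map fst \<sigma>) (map fst (h \<sigma>)))) = map snd (zip (map fst \<sigma>) (map fst (h \<sigma>)))"
  proof (rule back_and_forth[OF model countable_univ, where P = ?P])
    show "?P (zip (map fst \<sigma>) (map fst (h \<sigma>)))"
      using assms tree_automorphism_length[OF assms] by (intro bexI[of _ \<sigma>]) auto
  next
    fix zs assume "?P zs"
    then obtain \<sigma> where \<sigma>: "\<sigma> \<in> univ T" "map fst \<sigma> = map fst zs" "map fst (h \<sigma>) = map snd zs" by blast
    then have "map fst zs \<in> lists (univ A)" "map snd zs \<in> lists (univ A)"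
      using h_univ[OF \<sigma>(1)] by (metis in_univ_T)+
    then show "set zs \<subseteq> univ A \<times> univ A" by force
  next
    fix zs a assume P: "?P zs" and a: "a \<in> univ A"
    then obtain \<sigma> where \<sigma>: "\<sigma> \<in> univ T" "map fst \<sigma> = map fst zs" "map fst (h \<sigma>) = map snd zs" by blast
    let ?\<sigma> = "\<sigma> @ [(a, 0)]"
    have \<sigma>': "?\<sigma> \<in> univ T" using \<sigma>(1) a by (simp add: in_univ_T)
    have "butlast (h ?\<sigma>) = h \<sigma>" using tree_automorphism_butlast[OF \<sigma>'] by simp
    moreover have "h ?\<sigma> \<noteq> []" using tree_automorphism_length[OF \<sigma>'] by auto
    ultimately have "h ?\<sigma> = h \<sigma> @ [last (h ?\<sigma>)]" by (metis append_butlast_last_id)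
    then have "map fst (h ?\<sigma>) = map snd (zs @ [(a, fst (last (h ?\<sigma>)))])"
      using \<sigma>(3) by (metis list.simps(8,9) map_append snd_conv)
    then show "\<exists>b. ?P (zs @ [(a, b)])"
      using \<sigma> \<sigma>' by (intro exI[of _ "fst (last (h ?\<sigma>))"] bexI[of _ ?\<sigma>]) auto
  next
    fix zs b assume P: "?P zs" and b: "b \<in> univ A"
    then obtain \<sigma> where \<sigma>: "\<sigma> \<in> univ T" "map fst \<sigma> = map fst zs" "map fst (h \<sigma>) = map snd zs" by blast
    let ?\<tau> = "h \<sigma> @ [(b, 0)]"
    have "?\<tau> \<in> univ T" using h_univ[OF \<sigma>(1)] b by (simp add: in_univ_T)
    then have "?\<tau> \<in> h ` univ T" unfolding bij_betw_imp_surj_on[OF bij] .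
    then obtain \<rho> where \<rho>: "\<rho> \<in> univ T" "h \<rho> = ?\<tau>" by (metis imageE)
    \<comment> \<open>The preimage of a child of \<open>h \<sigma>\<close> is a child of
      \<open>\<sigma>\<close>, as \<open>h\<close> respects parents and is injective.\<close>
    have "h (butlast \<rho>) = h \<sigma>" using tree_automorphism_butlast[OF \<rho>(1)] \<rho>(2) by simp
    moreover have "butlast \<rho> \<in> univ T" using take_in_univ_T[OF \<rho>(1)] by (simp add: butlast_conv_take)
    ultimately have "butlast \<rho> = \<sigma>" using bij_betw_imp_inj_on[OF bij] \<sigma>(1) by (simp add: inj_on_eq_iff)
    moreover have "\<rho> \<noteq> []" using tree_automorphism_length[OF \<rho>(1)] \<rho>(2) by auto
    ultimately have "\<rho> = \<sigma> @ [last \<rho>]" by (metis append_butlast_last_id)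
    then have "map fst \<rho> = map fst (zs @ [(fst (last \<rho>), b)])"
      using \<sigma>(2) by (metis list.simps(8,9) map_append fst_conv)
    then show "\<exists>a. ?P (zs @ [(a, b)])"
      using \<rho> \<sigma>(3) by (intro exI[of _ "fst (last \<rho>)"] bexI[of _ \<rho>]) auto
  next
    fix a assume "atom_in V a"
    then obtain j where j: "e j = a" using atom_in_enum by blast
    show "\<exists>N. \<forall>zs. ?P zs \<longrightarrow> N \<le> length zs \<longrightarrow> atom_vars a \<subseteq> {..<length zs} \<longrightarrow>
        (atom_sat A ((!) (map fst zs)) a \<longleftrightarrow> atom_sat A ((!) (map snd zs)) a)"
    \<comment> \<open>Atom number \<open>j\<close> enters the diagram at length
      \<open>j + 1\<close>.\<close>
    proof (intro exI[of _ "Suc j"] allI impI)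
      fix zs assume P: "?P zs" and len: "Suc j \<le> length zs" and vars: "atom_vars a \<subseteq> {..<length zs}"
      obtain \<sigma> where \<sigma>: "\<sigma> \<in> univ T" "map fst \<sigma> = map fst zs" "map fst (h \<sigma>) = map snd zs"
        using P by blast
      have "finite_diagram e A (map fst zs) = finite_diagram e A (map snd zs)"
        using tree_automorphism_label[OF \<sigma>(1)] \<sigma> by (simp add: tuple_label_eq_iff)
      then have "finite_diagram e A (map fst zs) ! j = finite_diagram e A (map snd zs) ! j" by simp
      then show "atom_sat A ((!) (map fst zs)) a \<longleftrightarrow> atom_sat A ((!) (map snd zs)) a"
        using len vars j by (simp add: finite_diagram_nth)
    qed
  qed
  then obtain g where g: "automorphism V A g" "map g (map fst (zip (map fst \<sigma>) (map fst (h \<sigma>)))) =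
      map snd (zip (map fst \<sigma>) (map fst (h \<sigma>)))" by blast
  then have "map fst (h \<sigma>) = map g (map fst \<sigma>)"
    using tree_automorphism_length[OF assms] by (simp del: map_map)
  then show ?thesis using g(1) unfolding orbit_def by blast
qed

end

text \<open>A partial isomorphism of the tree with one orbit condition per node instead of a joint
  one. Comparing truncations at every common height covers equality, order and meets; labels and
  lengths are controlled by the orbit clause.\<close>

definition tree_sim :: "(('a \<times> nat) list \<times> ('a \<times> nat) list) set \<Rightarrow> bool"
  where "tree_sim Z \<longleftrightarrow>
    (\<forall>\<sigma> \<sigma>'. (\<sigma>, \<sigma>') \<in> Z \<longrightarrow> \<sigma> \<in> univ T \<and> \<sigma>' \<in> univ T \<and> map fst \<sigma>' \<in> orbit V A (map fst \<sigma>)) \<and>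
    (\<forall>\<sigma> \<sigma>' \<tau> \<tau>' k. (\<sigma>, \<sigma>') \<in> Z \<longrightarrow> (\<tau>, \<tau>') \<in> Z \<longrightarrow> k \<le> length \<sigma> \<longrightarrow> k \<le> length \<tau> \<longrightarrow>
      (take k \<sigma> = take k \<tau> \<longleftrightarrow> take k \<sigma>' = take k \<tau>'))"

lemma tree_simD:
  assumes "tree_sim Z" "(\<sigma>, \<sigma>') \<in> Z"
  shows "\<sigma> \<in> univ T" "\<sigma>' \<in> univ T" "map fst \<sigma>' \<in> orbit V A (map fst \<sigma>)" "length \<sigma>' = length \<sigma>"
proof -
  show "\<sigma> \<in> univ T" "\<sigma>' \<in> univ T" and *: "map fst \<sigma>' \<in> orbit V A (map fst \<sigma>)"
    using assms unfolding tree_sim_def by simp_all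
  show "length \<sigma>' = length \<sigma>" using orbit_length[OF *] by simp
qed

lemma tree_sim_take:
  assumes "tree_sim Z" "(\<sigma>, \<sigma>') \<in> Z" "(\<tau>, \<tau>') \<in> Z" "k \<le> length \<sigma>" "k \<le> length \<tau>"
  shows "take k \<sigma> = take k \<tau> \<longleftrightarrow> take k \<sigma>' = take k \<tau>'"
  using assms(1)[unfolded tree_sim_def, THEN conjunct2, rule_format, OF assms(2-5)] .

text \<open>Automorphisms invert and lengths agree, so the clauses are symmetric; the back step thus
  becomes a forth step for the swapped relation.\<close>

lemma tree_sim_swap:
  assumes "tree_sim Z"
  shows "tree_sim (prod.swap ` Z)"
  unfolding tree_sim_def
proof (intro conjI allI impI)
  fix \<sigma> \<sigma>' assume "(\<sigma>', \<sigma>) \<in> prod.swap ` Z"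
  then have "(\<sigma>, \<sigma>') \<in> Z" by auto
  note sim = tree_simD[OF assms this]
  show "\<sigma>' \<in> univ T" "\<sigma> \<in> univ T" by (fact sim)+
  show "map fst \<sigma> \<in> orbit V A (map fst \<sigma>')"
    using orbit_sym[OF model _ sim(3)] sim(1) by (simp add: in_univ_T)
next
  fix \<sigma> \<sigma>' \<tau> \<tau>' k assume *: "(\<sigma>', \<sigma>) \<in> prod.swap ` Z" "(\<tau>', \<tau>) \<in> prod.swap ` Z"
    "k \<le> length \<sigma>'" "k \<le> length \<tau>'"
  then have Z: "(\<sigma>, \<sigma>') \<in> Z" "(\<tau>, \<tau>') \<in> Z" by auto
  then show "take k \<sigma>' = take k \<tau>' \<longleftrightarrow> take k \<sigma> = take k \<tau>"
    using tree_sim_take[OF assms Z, of k] tree_simD(4)[OF assms Z(1)] tree_simD(4)[OF assms Z(2)] *(3,4)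
    by simp
qed

text \<open>Here the replication of branches is needed: above the meet with the nodes already mapped, the
  image of \<open>\<tau>\<close> uses a copy number that occurs in no image so far.\<close>

lemma tree_sim_extend:
  assumes sim: "tree_sim Z" and fin: "finite Z" and \<tau>: "\<tau> \<in> univ T"
  shows "\<exists>\<tau>'. tree_sim (insert (\<tau>, \<tau>') Z)"
proof -
  \<comment> \<open>\<open>k\<close> is the height at which \<open>\<tau>\<close> leaves the nodes
    treated so far, and \<open>\<rho>'\<close> is the image already forced on its first
    \<open>k\<close> entries.\<close>
  obtain k \<rho>' where k: "k \<le> length \<tau>" and \<rho>': "\<rho>' \<in> univ T" "map fst \<rho>' \<in> orbit V A (map fst (take k \<tau>))"
    and below: "\<And>\<sigma> \<sigma>' l. (\<sigma>, \<sigma>') \<in> Z \<Longrightarrow> l \<le> k \<Longrightarrow> l \<le> length \<sigma> \<Longrightarrow>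
      take l \<sigma> = take l \<tau> \<longleftrightarrow> take l \<sigma>' = take l \<rho>'"
    and above: "\<And>\<sigma> \<sigma>' l. (\<sigma>, \<sigma>') \<in> Z \<Longrightarrow> k < l \<Longrightarrow> l \<le> length \<sigma> \<Longrightarrow> l \<le> length \<tau> \<Longrightarrow>
      take l \<sigma> \<noteq> take l \<tau>"
  proof (cases "Z = {}")
    case True
    show ?thesis
      by (rule that[of 0 "[]"]) (use True in \<open>auto simp: orbit_Nil in_univ_T\<close>)
  next
    case False
    define K where "K = {k. k \<le> length \<tau> \<and> (\<exists>(\<sigma>, \<sigma>')\<in>Z. k \<le> length \<sigma> \<and> take k \<sigma> = take k \<tau>)}"
    have "finite K" by (rule finite_subset[of _ "{..length \<tau>}"]) (auto simp: K_def)
    moreover have "0 \<in> K" using False by (auto simp: K_def)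
    ultimately have max: "Max K \<in> K" "\<And>l. l \<in> K \<Longrightarrow> l \<le> Max K" by (auto intro: Max_in)
    define k where "k = Max K"
    obtain \<sigma>\<^sub>0 \<sigma>\<^sub>0' where \<sigma>\<^sub>0: "(\<sigma>\<^sub>0, \<sigma>\<^sub>0') \<in> Z" "k \<le> length \<sigma>\<^sub>0" "take k \<sigma>\<^sub>0 = take k \<tau>" and k: "k \<le> length \<tau>"
      using max(1) by (auto simp: K_def k_def)
    show ?thesis
    proof (rule that[of k "take k \<sigma>\<^sub>0'"])
      show "k \<le> length \<tau>" by (rule k)
      show "take k \<sigma>\<^sub>0' \<in> univ T" using tree_simD(2)[OF sim \<sigma>\<^sub>0(1)] by (rule take_in_univ_T)
      show "map fst (take k \<sigma>\<^sub>0') \<in> orbit V A (map fst (take k \<tau>))"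
        using orbit_take[OF tree_simD(3)[OF sim \<sigma>\<^sub>0(1)], of k] \<sigma>\<^sub>0(3) by (metis take_map)
    next
      fix \<sigma> \<sigma>' l assume \<sigma>: "(\<sigma>, \<sigma>') \<in> Z" "l \<le> k" "l \<le> length \<sigma>"
      have "take l \<tau> = take l \<sigma>\<^sub>0" using \<sigma>\<^sub>0(3) \<sigma>(2) by (metis min.absorb1 take_take)
      then show "take l \<sigma> = take l \<tau> \<longleftrightarrow> take l \<sigma>' = take l (take k \<sigma>\<^sub>0')"
        using tree_sim_take[OF sim \<sigma>(1) \<sigma>\<^sub>0(1), of l] \<sigma> \<sigma>\<^sub>0(2) by (simp add: min_def)
    next
      fix \<sigma> \<sigma>' l assume "(\<sigma>, \<sigma>') \<in> Z" "k < l" "l \<le> length \<sigma>" "l \<le> length \<tau>"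
      then have "l \<in> K" if "take l \<sigma> = take l \<tau>" using that by (auto simp: K_def)
      then show "take l \<sigma> \<noteq> take l \<tau>" using max(2)[of l] \<open>k < l\<close> by (auto simp: k_def)
    qed
  qed
  obtain g where g: "automorphism V A g" "map fst \<rho>' = map g (map fst (take k \<tau>))"
    using \<rho>'(2) by (auto simp: orbit_def)
  have len: "length \<rho>' = k" using arg_cong[OF g(2), of length] k by simp
  have "finite (\<Union>(\<sigma>, \<sigma>')\<in>Z. snd ` set \<sigma>')" using fin by auto
  then obtain c where c: "c \<notin> (\<Union>(\<sigma>, \<sigma>')\<in>Z. snd ` set \<sigma>')"
    using ex_new_if_finite[OF infinite_UNIV_nat] by blast
  \<comment> \<open>Up to height \<open>k\<close> the forced image is kept; above it the entries are
    moved by the same \<open>g\<close> that carries the first \<open>k\<close> entries to those of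
    \<open>\<rho>'\<close>, so the whole tuple stays in its orbit. All new steps get the fresh copy
    number \<open>c\<close>.\<close>
  define \<tau>' where "\<tau>' = \<rho>' @ map (\<lambda>x. (g (fst x), c)) (drop k \<tau>)"
  have len': "length \<tau>' = length \<tau>" using len k by (simp add: \<tau>'_def)
  have fst: "map fst \<tau>' = map g (map fst \<tau>)"
  proof -
    have "map fst \<tau>' = map g (map fst (take k \<tau>)) @ map g (map fst (drop k \<tau>))"
      using g(2) by (simp add: \<tau>'_def)
    then show ?thesis by (metis append_take_drop_id map_append)
  qed
  have orb: "map fst \<tau>' \<in> orbit V A (map fst \<tau>)" using fst g(1) by (auto simp: orbit_def)
  have \<tau>'_univ: "\<tau>' \<in> univ T"
    using \<tau> fst automorphism_in_univ[OF g(1)] unfolding in_univ_T by force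
  have key: "take l \<sigma> = take l \<tau> \<longleftrightarrow> take l \<sigma>' = take l \<tau>'"
    if \<sigma>: "(\<sigma>, \<sigma>') \<in> Z" "l \<le> length \<sigma>" "l \<le> length \<tau>" for \<sigma> \<sigma>' l
  proof (cases "l \<le> k")
    case True
    then have "take l \<tau>' = take l \<rho>'" using len by (simp add: \<tau>'_def)
    then show ?thesis using below[OF \<sigma>(1) True \<sigma>(2)] by simp
  next
    case False
    then have l: "k < l" by simp
    \<comment> \<open>At position \<open>k\<close> the copy number \<open>c\<close> separates
      \<open>\<tau>'\<close> from every earlier image, just as \<open>\<tau>\<close> has left the
      earlier nodes by then.\<close>
    have "take l \<sigma>' \<noteq> take l \<tau>'"
    proof
      assume "take l \<sigma>' = take l \<tau>'"
      then have "take l \<sigma>' ! k = take l \<tau>' ! k" by simp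
      then have "\<sigma>' ! k = \<tau>' ! k" using l by simp
      moreover have "snd (\<tau>' ! k) = c" using l \<sigma>(3) len k by (simp add: \<tau>'_def nth_append)
      moreover have "\<sigma>' ! k \<in> set \<sigma>'" using l \<sigma>(2) tree_simD(4)[OF sim \<sigma>(1)] by simp
      ultimately show False using c \<sigma>(1) by force
    qed
    then show ?thesis using above[OF \<sigma>(1) l \<sigma>(2,3)] by simp
  qed
  have "tree_sim (insert (\<tau>, \<tau>') Z)"
    unfolding tree_sim_def
  proof (intro conjI allI impI)
    fix \<sigma> \<sigma>' assume *: "(\<sigma>, \<sigma>') \<in> insert (\<tau>, \<tau>') Z"
    show "\<sigma> \<in> univ T" using * \<tau> tree_simD(1)[OF sim] by blast
    show "\<sigma>' \<in> univ T" using * \<tau>'_univ tree_simD(2)[OF sim] by blast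
    show "map fst \<sigma>' \<in> orbit V A (map fst \<sigma>)" using * orb tree_simD(3)[OF sim] by blast
  next
    fix \<sigma> \<sigma>' \<upsilon> \<upsilon>' l
    assume *: "(\<sigma>, \<sigma>') \<in> insert (\<tau>, \<tau>') Z" "(\<upsilon>, \<upsilon>') \<in> insert (\<tau>, \<tau>') Z" "l \<le> length \<sigma>" "l \<le> length \<upsilon>"
    consider "(\<sigma>, \<sigma>') \<in> Z" "(\<upsilon>, \<upsilon>') \<in> Z" | "(\<sigma>, \<sigma>') \<in> Z" "\<upsilon> = \<tau>" "\<upsilon>' = \<tau>'"
      | "\<sigma> = \<tau>" "\<sigma>' = \<tau>'" "(\<upsilon>, \<upsilon>') \<in> Z" | "\<sigma> = \<tau>" "\<sigma>' = \<tau>'" "\<upsilon> = \<tau>" "\<upsilon>' = \<tau>'"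
      using *(1,2) by blast
    then show "take l \<sigma> = take l \<upsilon> \<longleftrightarrow> take l \<sigma>' = take l \<upsilon>'"
    proof cases
      case 1
      then show ?thesis using tree_sim_take[OF sim] *(3,4) by blast
    next
      case 2
      then show ?thesis using key[of \<sigma> \<sigma>' l] *(3,4) by simp
    next
      case 3
      then show ?thesis using key[of \<upsilon> \<upsilon>' l] *(3,4) by (simp add: eq_commute)
    qed simp
  qed
  then show ?thesis by blast
qed

text \<open>Atoms only compare ancestors or read their labels. Comparisons reduce to a common depth;
  labels agree because initial segments of tuples in one orbit are again in one orbit.\<close>

lemma tree_sim_atom_sat:
  assumes sim: "tree_sim (set zs)" and a: "atom_in tree_vocabulary a" "atom_vars a \<subseteq> {..<length zs}"
  shows "atom_sat T ((!) (map fst zs)) a \<longleftrightarrow> atom_sat T ((!) (map snd zs)) a"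
proof -
  have zs: "(fst (zs ! i), snd (zs ! i)) \<in> set zs" if "i < length zs" for i using that by simp
  have take_iff: "take k (fst (zs ! i)) = take k (fst (zs ! j)) \<longleftrightarrow> take k (snd (zs ! i)) = take k (snd (zs ! j))"
    if "i < length zs" "j < length zs" "k \<le> length (fst (zs ! i))" "k \<le> length (fst (zs ! j))" for i j k
    by (rule tree_sim_take[OF sim zs[OF that(1)] zs[OF that(2)] that(3,4)])
  have len: "length (snd (zs ! i)) = length (fst (zs ! i))" if "i < length zs" for i
    by (rule tree_simD(4)[OF sim zs[OF that]])
  have take_take_iff: "take k (fst (zs ! i)) = take l (fst (zs ! j)) \<longleftrightarrow> take k (snd (zs ! i)) = take l (snd (zs ! j))"
    if "i < length zs" "j < length zs" "k \<le> length (fst (zs ! i))" "l \<le> length (fst (zs ! j))" for i j k l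
    using take_eq_take_iff[OF that(3,4)] take_eq_take_iff[of k "snd (zs ! i)" l "snd (zs ! j)"]
      take_iff[of i j k] len that by auto
  have prefix_iff: "prefix (take k (fst (zs ! i))) (take l (fst (zs ! j))) \<longleftrightarrow>
      prefix (take k (snd (zs ! i))) (take l (snd (zs ! j)))"
    if "i < length zs" "j < length zs" "k \<le> length (fst (zs ! i))" "l \<le> length (fst (zs ! j))" for i j k l
    using prefix_take_take_iff[OF that(3,4)] prefix_take_take_iff[of k "snd (zs ! i)" l "snd (zs ! j)"]
      take_iff[of i j k] len that by auto
  have label: "tuple_label e A (map fst (take k (snd (zs ! i)))) = tuple_label e A (map fst (take k (fst (zs ! i))))"
    if "i < length zs" for i k
    using tree_simD(1,3)[OF sim zs[OF that]] orbit_take[of "map fst (snd (zs ! i))" V A "map fst (fst (zs ! i))" k]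
      take_in_univ_T[of "fst (zs ! i)" k]
    by (intro tuple_label_orbit) (simp_all add: in_univ_T take_map)
  from a(1) show ?thesis
  proof (cases rule: atom_in_treeE)
    case (1 s t)
    obtain i j where s: "tm_vars s = {i}" "\<And>v. tm_val T v s = take (length (v i) - j) (v i)"
      by (rule tm_val_tree[OF 1(2), of e A]) blast
    obtain i' j' where t: "tm_vars t = {i'}" "\<And>v. tm_val T v t = take (length (v i') - j') (v i')"
      by (rule tm_val_tree[OF 1(3), of e A]) blast
    have "i < length zs" "i' < length zs" using a(2) 1(1) s(1) t(1) by auto
    then show ?thesis
      unfolding 1(1) by (simp add: s t len take_take_iff)
  next
    case (2 s t)
    obtain i j where s: "tm_vars s = {i}" "\<And>v. tm_val T v s = take (length (v i) - j) (v i)"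
      by (rule tm_val_tree[OF 2(2), of e A]) blast
    obtain i' j' where t: "tm_vars t = {i'}" "\<And>v. tm_val T v t = take (length (v i') - j') (v i')"
      by (rule tm_val_tree[OF 2(3), of e A]) blast
    have "i < length zs" "i' < length zs" using a(2) 2(1) s(1) t(1) by auto
    then show ?thesis
      unfolding 2(1) by (simp add: s t rel_int_tree len prefix_iff)
  next
    case (3 n t)
    obtain i j where t: "tm_vars t = {i}" "\<And>v. tm_val T v t = take (length (v i) - j) (v i)"
      by (rule tm_val_tree[OF 3(2), of e A]) blast
    have "i < length zs" using a(2) 3(1) t(1) by auto
    then show ?thesis unfolding 3(1) by (simp add: t rel_int_tree len label)
  qed
qed

lemma tree_sim_imp_automorphism:
  assumes "tree_sim (set zs)"
  shows "\<exists>h. automorphism tree_vocabulary T h \<and> map h (map fst zs) = map snd zs"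
proof (rule back_and_forth[OF is_model_T countable_univ_T, where P = "\<lambda>zs. tree_sim (set zs)"])
  show "tree_sim (set zs)" by (rule assms)
next
  show "set zs \<subseteq> univ T \<times> univ T" if "tree_sim (set zs)" for zs
    using tree_simD(1,2)[OF that] by auto
next
  show "\<exists>\<tau>'. tree_sim (set (zs @ [(\<tau>, \<tau>')]))" if "tree_sim (set zs)" "\<tau> \<in> univ T" for zs \<tau>
    using tree_sim_extend[OF that(1) _ that(2)] by simp
next
  fix zs \<tau> assume zs: "tree_sim (set zs)" and \<tau>: "\<tau> \<in> univ T"
  obtain \<tau>' where "tree_sim (insert (\<tau>, \<tau>') (prod.swap ` set zs))"
    using tree_sim_extend[OF tree_sim_swap[OF zs] _ \<tau>] by auto
  from tree_sim_swap[OF this] have "tree_sim (insert (\<tau>', \<tau>) (set zs))" by (simp add: image_image)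
  then show "\<exists>\<tau>'. tree_sim (set (zs @ [(\<tau>', \<tau>)]))" by auto
next
  show "\<exists>N. \<forall>zs. tree_sim (set zs) \<longrightarrow> N \<le> length zs \<longrightarrow> atom_vars a \<subseteq> {..<length zs} \<longrightarrow>
      (atom_sat T ((!) (map fst zs)) a \<longleftrightarrow> atom_sat T ((!) (map snd zs)) a)"
    if "atom_in tree_vocabulary a" for a
    using tree_sim_atom_sat[OF _ that] by blast
qed

text \<open>A tree automorphism commutes with truncation and moves tuples inside their orbits;
  conversely, back-and-forth extends a similarity. Membership in \<open>tuples T m\<close> fixes the
  length, since \<open>zip\<close> would cut a longer list silently.\<close>

lemma orbit_tree_iff:
  assumes \<sigma>s: "\<sigma>s \<in> tuples T m"
  shows "\<sigma>s' \<in> orbit tree_vocabulary T \<sigma>s \<longleftrightarrow> \<sigma>s' \<in> tuples T m \<and> tree_sim (set (zip \<sigma>s \<sigma>s'))"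
proof
  assume "\<sigma>s' \<in> orbit tree_vocabulary T \<sigma>s"
  then obtain h where h: "automorphism tree_vocabulary T h" and \<sigma>s': "\<sigma>s' = map h \<sigma>s"
    by (auto simp: orbit_def)
  have sub: "\<sigma> \<in> univ T" if "\<sigma> \<in> set \<sigma>s" for \<sigma> using \<sigma>s that by (auto simp: tuples_def)
  have zip: "set (zip \<sigma>s \<sigma>s') = (\<lambda>\<sigma>. (\<sigma>, h \<sigma>)) ` set \<sigma>s"
    unfolding \<sigma>s' by (simp add: zip_map2 zip_same_conv_map image_image)
  have "take k \<sigma> = take k \<tau> \<longleftrightarrow> take k (h \<sigma>) = take k (h \<tau>)" if "\<sigma> \<in> set \<sigma>s" "\<tau> \<in> set \<sigma>s" for \<sigma> \<tau> k
  proof -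
    have "inj_on h (univ T)" using h by (simp add: automorphism_def bij_betw_def)
    then have "h (take k \<sigma>) = h (take k \<tau>) \<longleftrightarrow> take k \<sigma> = take k \<tau>"
      using that sub take_in_univ_T by (intro inj_on_eq_iff) auto
    then show ?thesis using tree_automorphism_take[OF h] sub that by simp
  qed
  then have "tree_sim (set (zip \<sigma>s \<sigma>s'))"
    unfolding tree_sim_def zip
    using sub automorphism_in_univ[OF h] tree_automorphism_orbit[OF h]
    by (intro conjI allI impI) auto
  then show "\<sigma>s' \<in> tuples T m \<and> tree_sim (set (zip \<sigma>s \<sigma>s'))"
    using automorphism_map_tuples[OF h \<sigma>s] \<sigma>s' by simp
next
  assume *: "\<sigma>s' \<in> tuples T m \<and> tree_sim (set (zip \<sigma>s \<sigma>s'))"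
  then obtain h where "automorphism tree_vocabulary T h"
    "map h (map fst (zip \<sigma>s \<sigma>s')) = map snd (zip \<sigma>s \<sigma>s')"
    using tree_sim_imp_automorphism by blast
  moreover have "length \<sigma>s = length \<sigma>s'" using * \<sigma>s by (simp add: tuples_def)
  ultimately show "\<sigma>s' \<in> orbit tree_vocabulary T \<sigma>s" by (auto simp: orbit_def)
qed

text \<open>For one node the truncation clause compares the node with itself, so only the orbit in A
  remains, whatever the copy numbers.\<close>

lemma orbit_node_iff:
  assumes "\<sigma> \<in> univ T" "\<sigma>' \<in> univ T"
  shows "[\<sigma>'] \<in> orbit tree_vocabulary T [\<sigma>] \<longleftrightarrow> map fst \<sigma>' \<in> orbit V A (map fst \<sigma>)"
  using orbit_tree_iff[of "[\<sigma>]" 1 "[\<sigma>']"] assms by (simp add: tuples_def tree_sim_def)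

end

section \<open>From the tree to the structure\<close>

text \<open>A shape lists the copy numbers of the nodes of a tuple of the tree. Once the shape is fixed, such
  a tuple is coded by the concatenation of the underlying tuples of \<open>A\<close>.\<close>

primrec assemble :: "nat list list \<Rightarrow> 'a list \<Rightarrow> ('a \<times> nat) list list"
where
  "assemble [] as = []"
| "assemble (\<kappa> # s) as = zip (take (length \<kappa>) as) \<kappa> # assemble s (drop (length \<kappa>) as)"

definition shape_size :: "nat list list \<Rightarrow> nat"
  where "shape_size s = sum_list (map length s)"

lemma shape_size_append: "shape_size (s @ t) = shape_size s + shape_size t"
  by (simp add: shape_size_def)

lemma assemble_append:
  "length as = shape_size s \<Longrightarrow> assemble (s @ t) (as @ bs) = assemble s as @ assemble t bs"
  by (induction s arbitrary: as) (auto simp: shape_size_def)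

text \<open>The offset, the total length of the earlier blocks, is independent of \<open>as\<close>.
  So each node occupies fixed positions of the code, and formulas can speak about it.\<close>

lemma assemble_nth:
  assumes "i < length s"
  shows "\<exists>off. off + length (s ! i) \<le> shape_size s \<and>
    (\<forall>as :: 'a list. length as = shape_size s \<longrightarrow>
      assemble s as ! i = zip (take (length (s ! i)) (drop off as)) (s ! i))"
  using assms
proof (induction s arbitrary: i)
  case (Cons \<kappa> s)
  show ?case
  proof (cases i)
    case 0
    then show ?thesis by (intro exI[of _ 0]) (simp add: shape_size_def)
  next
    case (Suc j)
    then obtain off where off: "off + length (s ! j) \<le> shape_size s"
      "\<forall>as :: 'a list. length as = shape_size s \<longrightarrow>
        assemble s as ! j = zip (take (length (s ! j)) (drop off as)) (s ! j)"
      using Cons.IH[of j] Cons.prems by auto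
    show ?thesis
      using off Suc by (intro exI[of _ "off + length \<kappa>"]) (auto simp: shape_size_def)
  qed
qed simp

context tuple_tree
begin

section \<open>Atomic facts about assembled nodes\<close>

lemma assemble_in_tuples:
  "as \<in> tuples A (shape_size s) \<Longrightarrow> assemble s as \<in> tuples T (length s)"
proof (induction s arbitrary: as)
  case Nil
  then show ?case by (simp add: tuples_def)
next
  case (Cons \<kappa> s)
  have "drop (length \<kappa>) as \<in> tuples A (shape_size s)"
    using Cons.prems by (auto simp: tuples_def shape_size_def dest: in_set_dropD)
  moreover have "zip (take (length \<kappa>) as) \<kappa> \<in> univ T"
    using Cons.prems
    by (auto simp: in_univ_T tuples_def shape_size_def dest!: set_zip_leftD dest: in_set_takeD)
  ultimately show ?case using Cons.IH by (auto simp: tuples_def)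
qed

lemma assemble_map_snd:
  assumes "\<sigma>s \<in> tuples T m"
  shows "concat (map (map fst) \<sigma>s) \<in> tuples A (shape_size (map (map snd) \<sigma>s))"
    and "assemble (map (map snd) \<sigma>s) (concat (map (map fst) \<sigma>s)) = \<sigma>s"
proof -
  have "\<forall>\<sigma>\<in>set \<sigma>s. map fst \<sigma> \<in> lists (univ A)"
    unfolding in_univ_T[symmetric] using assms by (auto simp: tuples_def)
  then show "concat (map (map fst) \<sigma>s) \<in> tuples A (shape_size (map (map snd) \<sigma>s))"
    by (induction \<sigma>s) (auto simp: tuples_def shape_size_def)
  show "assemble (map (map snd) \<sigma>s) (concat (map (map fst) \<sigma>s)) = \<sigma>s"
    by (induction \<sigma>s) (auto simp: zip_map_fst_snd)
qed

text \<open>An ancestor is an initial part of the block of its node: same offset, shorter list of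
  copy numbers.\<close>

lemma tm_val_assemble:
  assumes "tm_in tree_vocabulary t" "tm_vars t \<subseteq> {..<length s}"
  obtains off \<kappa> where "off + length \<kappa> \<le> shape_size s"
    "\<And>as. as \<in> tuples A (shape_size s) \<Longrightarrow>
      tm_val T ((!) (assemble s as)) t = zip (take (length \<kappa>) (drop off as)) \<kappa>"
proof -
  obtain i j where t: "tm_vars t = {i}" "\<And>v. tm_val T v t = take (length (v i) - j) (v i)"
    by (rule tm_val_tree[OF assms(1), of e A]) blast
  obtain off where off: "off + length (s ! i) \<le> shape_size s"
    "\<forall>as :: 'a list. length as = shape_size s \<longrightarrow>
      assemble s as ! i = zip (take (length (s ! i)) (drop off as)) (s ! i)"
    using assemble_nth[of i s] assms(2) t(1) by auto
  show ?thesis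
  proof (rule that[of off "take (length (s ! i) - j) (s ! i)"])
    show "off + length (take (length (s ! i) - j) (s ! i)) \<le> shape_size s" using off(1) by simp
    fix as assume "as \<in> tuples A (shape_size s)"
    then have len: "length as = shape_size s" by (simp add: tuples_def)
    let ?z = "zip (take (length (s ! i)) (drop off as)) (s ! i)"
    have "length ?z = length (s ! i)" using len off(1) by simp
    then have "tm_val T ((!) (assemble s as)) t = take (length (s ! i) - j) ?z"
      using off(2) len by (simp only: t(2))
    also have "\<dots> = zip (take (length (s ! i) - j) (drop off as)) (take (length (s ! i) - j) (s ! i))"
      by (simp add: take_zip min.absorb1)
    finally show "tm_val T ((!) (assemble s as)) t =
        zip (take (length (take (length (s ! i) - j) (s ! i))) (drop off as)) (take (length (s ! i) - j) (s ! i))"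
      by (simp add: min.absorb1)
  qed
qed

text \<open>Copy numbers are constants of the shape, so comparing them is decided outside the
  formula; finitely many equations between entries remain.\<close>

lemma qf_definable_block_eq:
  assumes "off + length \<kappa> \<le> n" "off' + length \<kappa>' \<le> n"
  shows "qf_definable V A n (\<lambda>as. zip (take (length \<kappa>) (drop off as)) \<kappa> =
    zip (take (length \<kappa>') (drop off' as)) \<kappa>')"
proof -
  have "qf_definable V A n (\<lambda>as. as ! p = as ! q)" if "p < n" "q < n" for p q
    using qf_definable_atom[of V "Eq (Var 0) (Var 1)" "\<lambda>x. if x = 0 then p else q" n A] that
    by (simp split: if_splits)
  \<comment> \<open>The minimum keeps all positions in range also when \<open>\<kappa>\<close> and
    \<open>\<kappa>'\<close> differ in length.\<close>
  then have "qf_definable V A n (\<lambda>as. \<kappa> = \<kappa>' \<and> (\<forall>i\<in>{..<min (length \<kappa>) (length \<kappa>')}. as ! (off + i) = as ! (off' + i)))"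
    using assms by (intro qf_definable_and qf_definable_const qf_definable_Ball) auto
  then show ?thesis
  proof (rule qf_definable_cong)
    fix as assume "as \<in> tuples A n"
    then have len: "length as = n" by (simp add: tuples_def)
    let ?x = "take (length \<kappa>) (drop off as)" and ?y = "take (length \<kappa>') (drop off' as)"
    have l: "length ?x = length \<kappa>" "length ?y = length \<kappa>'" using len assms by auto
    have "zip ?x \<kappa> = zip ?y \<kappa>' \<longleftrightarrow> ?x = ?y \<and> \<kappa> = \<kappa>'"
    proof
      assume *: "zip ?x \<kappa> = zip ?y \<kappa>'"
      then show "?x = ?y \<and> \<kappa> = \<kappa>'" using l by (metis map_fst_zip map_snd_zip)
    qed auto
    moreover have "?x = ?y \<longleftrightarrow> (\<forall>i\<in>{..<length \<kappa>}. as ! (off + i) = as ! (off' + i))" if "\<kappa> = \<kappa>'"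
      using l that len assms by (auto simp: list_eq_iff_nth_eq)
    ultimately show "(\<kappa> = \<kappa>' \<and> (\<forall>i\<in>{..<min (length \<kappa>) (length \<kappa>')}. as ! (off + i) = as ! (off' + i))) \<longleftrightarrow>
        zip ?x \<kappa> = zip ?y \<kappa>'" by auto
  qed
qed

lemma qf_definable_block_prefix:
  assumes "off + length \<kappa> \<le> n" "off' + length \<kappa>' \<le> n"
  shows "qf_definable V A n (\<lambda>as. prefix (zip (take (length \<kappa>) (drop off as)) \<kappa>)
    (zip (take (length \<kappa>') (drop off' as)) \<kappa>'))"
proof -
  let ?\<kappa> = "take (length \<kappa>) \<kappa>'"
  have "qf_definable V A n (\<lambda>as. length \<kappa> \<le> length \<kappa>' \<and>
      zip (take (length \<kappa>) (drop off as)) \<kappa> = zip (take (length ?\<kappa>) (drop off' as)) ?\<kappa>)"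
    using assms by (intro qf_definable_and qf_definable_const qf_definable_block_eq) auto
  then show ?thesis
  proof (rule qf_definable_cong)
    fix as assume "as \<in> tuples A n"
    then have len: "length as = n" by (simp add: tuples_def)
    let ?x = "zip (take (length \<kappa>) (drop off as)) \<kappa>" and ?y = "zip (take (length \<kappa>') (drop off' as)) \<kappa>'"
    have l: "length ?x = length \<kappa>" "length ?y = length \<kappa>'" using len assms by auto
    have "prefix ?x ?y \<longleftrightarrow> length \<kappa> \<le> length \<kappa>' \<and> ?x = take (length \<kappa>) ?y"
      using prefix_take_take_iff[of "length \<kappa>" ?x "length \<kappa>'" ?y] l by simp
    moreover have "take (length \<kappa>) ?y = zip (take (length ?\<kappa>) (drop off' as)) ?\<kappa>"
      by (simp add: take_zip min_def)
    ultimately show "(length \<kappa> \<le> length \<kappa>' \<and> ?x = zip (take (length ?\<kappa>) (drop off' as)) ?\<kappa>) \<longleftrightarrow> prefix ?x ?y"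
      by simp
  qed
qed

text \<open>The block has fixed length, so its label depends on the truth values of finitely many
  atoms, shifted by \<open>off\<close>.\<close>

lemma qf_definable_block_label:
  assumes "off + k \<le> n"
  shows "qf_definable V A n (\<lambda>as. tuple_label e A (take k (drop off as)) = c)"
proof -
  let ?P = "\<lambda>i as. atom_vars (e i) \<subseteq> {..<k} \<and> atom_sat A (\<lambda>j. as ! (off + j)) (e i)"
  have "qf_definable V A n (?P i)" for i
  proof (cases "atom_vars (e i) \<subseteq> {..<k}")
    case True
    then show ?thesis
      using assms enum
      by (intro qf_definable_and qf_definable_const qf_definable_atom) (auto simp: enumerates_atoms_def)
  next
    case False
    then show ?thesis using qf_definable_const[of V A n False] by simp
  qed
  then have "qf_definable V A n (\<lambda>as. to_nat (k, map (\<lambda>i. ?P i as) [0..<k]) = c)"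
    by (rule qf_definable_map_upt)
  then show ?thesis
  proof (rule qf_definable_cong)
    fix as assume "as \<in> tuples A n"
    then have len: "length (take k (drop off as)) = k" using assms by (simp add: tuples_def)
    have "?P i as \<longleftrightarrow> atom_vars (e i) \<subseteq> {..<k} \<and> atom_sat A ((!) (take k (drop off as))) (e i)" for i
    proof -
      have "atom_sat A (\<lambda>j. as ! (off + j)) (e i) \<longleftrightarrow> atom_sat A ((!) (take k (drop off as))) (e i)"
        if "atom_vars (e i) \<subseteq> {..<k}"
        using that len by (intro atom_sat_cong) auto
      then show ?thesis by blast
    qed
    then have "finite_diagram e A (take k (drop off as)) = map (\<lambda>i. ?P i as) [0..<k]"
      unfolding finite_diagram_def len by simp
    then show "to_nat (k, map (\<lambda>i. ?P i as) [0..<k]) = c \<longleftrightarrow> tuple_label e A (take k (drop off as)) = c"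
      unfolding tuple_label_def len by simp
  qed
qed

lemma qf_definable_assemble:
  assumes "qf_in tree_vocabulary p" "qf_vars p \<subseteq> {..<length s}"
  shows "qf_definable V A (shape_size s) (\<lambda>as. qf_sat T ((!) (assemble s as)) p)"
  using assms
proof (induction p)
  case (Atom a)
  have "atom_in tree_vocabulary a" using Atom by simp
  then show ?case
  proof (cases rule: atom_in_treeE)
    case (1 t u)
    have vars: "tm_vars t \<subseteq> {..<length s}" "tm_vars u \<subseteq> {..<length s}" using Atom 1(1) by auto
    obtain off \<kappa> where t: "off + length \<kappa> \<le> shape_size s"
      "\<And>as. as \<in> tuples A (shape_size s) \<Longrightarrow>
        tm_val T ((!) (assemble s as)) t = zip (take (length \<kappa>) (drop off as)) \<kappa>"
      by (rule tm_val_assemble[OF 1(2) vars(1)]) blast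
    obtain off' \<kappa>' where u: "off' + length \<kappa>' \<le> shape_size s"
      "\<And>as. as \<in> tuples A (shape_size s) \<Longrightarrow>
        tm_val T ((!) (assemble s as)) u = zip (take (length \<kappa>') (drop off' as)) \<kappa>'"
      by (rule tm_val_assemble[OF 1(3) vars(2)]) blast
    show ?thesis
      by (rule qf_definable_cong[OF qf_definable_block_eq[OF t(1) u(1)]]) (simp add: 1(1) t u)
  next
    case (2 t u)
    have vars: "tm_vars t \<subseteq> {..<length s}" "tm_vars u \<subseteq> {..<length s}" using Atom 2(1) by auto
    obtain off \<kappa> where t: "off + length \<kappa> \<le> shape_size s"
      "\<And>as. as \<in> tuples A (shape_size s) \<Longrightarrow>
        tm_val T ((!) (assemble s as)) t = zip (take (length \<kappa>) (drop off as)) \<kappa>"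
      by (rule tm_val_assemble[OF 2(2) vars(1)]) blast
    obtain off' \<kappa>' where u: "off' + length \<kappa>' \<le> shape_size s"
      "\<And>as. as \<in> tuples A (shape_size s) \<Longrightarrow>
        tm_val T ((!) (assemble s as)) u = zip (take (length \<kappa>') (drop off' as)) \<kappa>'"
      by (rule tm_val_assemble[OF 2(3) vars(2)]) blast
    show ?thesis
      by (rule qf_definable_cong[OF qf_definable_block_prefix[OF t(1) u(1)]])
        (simp add: 2(1) t u rel_int_tree)
  next
    case (3 c t)
    have vars: "tm_vars t \<subseteq> {..<length s}" using Atom 3(1) by auto
    obtain off \<kappa> where t: "off + length \<kappa> \<le> shape_size s"
      "\<And>as. as \<in> tuples A (shape_size s) \<Longrightarrow>
        tm_val T ((!) (assemble s as)) t = zip (take (length \<kappa>) (drop off as)) \<kappa>"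
      by (rule tm_val_assemble[OF 3(2) vars(1)]) blast
    show ?thesis
    proof (rule qf_definable_cong[OF qf_definable_block_label[OF t(1), of c]])
      fix as assume as: "as \<in> tuples A (shape_size s)"
      then have "length (take (length \<kappa>) (drop off as)) = length \<kappa>" using t(1) by (simp add: tuples_def)
      then show "tuple_label e A (take (length \<kappa>) (drop off as)) = c \<longleftrightarrow>
          qf_sat T ((!) (assemble s as)) (Atom a)"
        by (simp add: 3(1) t(2)[OF as] rel_int_tree)
    qed
  qed
qed (auto intro: qf_definable_const qf_definable_not qf_definable_and qf_definable_or)

text \<open>The shapes of the quantified nodes join the index of the disjunction that the step
  already has, so the level does not rise; level 0 is included.\<close>

lemma Sigma_rel_assemble:
  assumes "Sigma_rel tree_vocabulary T \<alpha> m S" "length s = m"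
  shows "Sigma_rel V A \<alpha> (shape_size s) {as \<in> tuples A (shape_size s). assemble s as \<in> S}"
  using assms
proof (induction arbitrary: s rule: Sigma_rel.induct)
  case (Sigma_rel_0 m P)
  then obtain p where p: "qf_in tree_vocabulary p" "qf_vars p \<subseteq> {..<m}"
    "\<forall>\<sigma>s\<in>tuples T m. qf_sat T ((!) \<sigma>s) p \<longleftrightarrow> P \<sigma>s"
    unfolding qf_definable_def by blast
  have "Sigma_rel V A 0 (shape_size s) {as \<in> tuples A (shape_size s). qf_sat T ((!) (assemble s as)) p}"
    using p Sigma_rel_0.prems by (intro Sigma_rel.Sigma_rel_0 qf_definable_assemble) auto
  moreover have "{as \<in> tuples A (shape_size s). qf_sat T ((!) (assemble s as)) p} =
      {as \<in> tuples A (shape_size s). assemble s as \<in> {\<sigma>s \<in> tuples T m. P \<sigma>s}}"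
    using assemble_in_tuples[of _ s] p(3) Sigma_rel_0.prems by auto
  ultimately show ?case by (simp only:)
next
  case (Sigma_rel_step \<alpha> m k R)
  let ?I = "{(i :: nat, t :: nat list list). length t = k i}"
  let ?R = "\<lambda>(i, t). {as \<in> tuples A (shape_size (s @ t)). assemble (s @ t) as \<in> R i}"
  have "Sigma_rel V A \<alpha> (shape_size s) {as \<in> tuples A (shape_size s).
      \<exists>x\<in>?I. \<exists>bs\<in>tuples A (shape_size (snd x)). as @ bs \<notin> ?R x}"
  proof (rule Sigma_rel_countable[OF \<open>0 < \<alpha>\<close>])
    fix x assume "x \<in> ?I"
    then obtain i t where x: "x = (i, t)" "length t = k i" by auto
    obtain \<beta> where "\<beta> < \<alpha>" and IH: "\<And>s. length s = m + k i \<Longrightarrow>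
        Sigma_rel V A \<beta> (shape_size s) {as \<in> tuples A (shape_size s). assemble s as \<in> R i}"
      using Sigma_rel_step.IH[of i] by blast
    then show "\<exists>\<beta><\<alpha>. Sigma_rel V A \<beta> (shape_size s + shape_size (snd x)) (?R x)"
      using IH[of "s @ t"] x Sigma_rel_step.prems by (auto simp: shape_size_append)
  qed simp
  moreover have "{as \<in> tuples A (shape_size s). \<exists>x\<in>?I. \<exists>bs\<in>tuples A (shape_size (snd x)). as @ bs \<notin> ?R x} =
      {as \<in> tuples A (shape_size s). assemble s as \<in>
        {\<sigma>s \<in> tuples T m. \<exists>i. \<exists>\<tau>s\<in>tuples T (k i). \<sigma>s @ \<tau>s \<notin> R i}}"
  proof -
    have "(\<exists>x\<in>?I. \<exists>bs\<in>tuples A (shape_size (snd x)). as @ bs \<notin> ?R x) \<longleftrightarrow>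
        (\<exists>i. \<exists>\<tau>s\<in>tuples T (k i). assemble s as @ \<tau>s \<notin> R i)" (is "?L \<longleftrightarrow> ?R'")
      if as: "as \<in> tuples A (shape_size s)" for as
    proof
      have len: "length as = shape_size s" using as by (simp add: tuples_def)
      assume ?L
      then obtain i t bs where t: "length t = k i" and bs: "bs \<in> tuples A (shape_size t)" "as @ bs \<notin> ?R (i, t)"
        by auto
      have "as @ bs \<in> tuples A (shape_size (s @ t))"
        using tuples_append[OF as bs(1)] by (simp add: shape_size_append)
      then have "assemble s as @ assemble t bs \<notin> R i" using bs(2) assemble_append[OF len] by simp
      moreover have "assemble t bs \<in> tuples T (k i)" using assemble_in_tuples[OF bs(1)] t by simp
      ultimately show ?R' by blast
    next
      have len: "length as = shape_size s" using as by (simp add: tuples_def)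
      assume ?R'
      then obtain i \<tau>s where \<tau>s: "\<tau>s \<in> tuples T (k i)" "assemble s as @ \<tau>s \<notin> R i" by blast
      let ?t = "map (map snd) \<tau>s" and ?bs = "concat (map (map fst) \<tau>s)"
      have "assemble (s @ ?t) (as @ ?bs) \<notin> R i"
        using \<tau>s(2) assemble_append[OF len, of ?t ?bs] assemble_map_snd(2)[OF \<tau>s(1)] by simp
      then have "as @ ?bs \<notin> ?R (i, ?t)" by simp
      moreover have "?bs \<in> tuples A (shape_size (snd (i, ?t)))" using assemble_map_snd(1)[OF \<tau>s(1)] by simp
      moreover have "(i, ?t) \<in> ?I" using \<tau>s(1) by (simp add: tuples_def)
      ultimately show ?L by blast
    qed
    moreover have "assemble s as \<in> tuples T m" if "as \<in> tuples A (shape_size s)" for as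
      using assemble_in_tuples[OF that] Sigma_rel_step.prems by simp
    ultimately show ?thesis by blast
  qed
  ultimately show ?case by (simp only:)
qed

lemma Sigma_definable_orbit_of_tree:
  assumes "\<forall>\<sigma>s\<in>lists (univ T). Sigma_definable tree_vocabulary T \<alpha> (length \<sigma>s) (orbit tree_vocabulary T \<sigma>s)"
    and as: "as \<in> lists (univ A)"
  shows "Sigma_definable V A \<alpha> (length as) (orbit V A as)"
proof -
  let ?n = "length as"
  \<comment> \<open>The node over \<open>as\<close> with all copy numbers 0; the same shape turns
    every tuple \<open>bs\<close> into a node, and \<open>orbit_node_iff\<close> compares the
    two.\<close>
  let ?s = "[replicate ?n 0]" and ?\<sigma> = "zip as (replicate ?n 0) :: ('a \<times> nat) list"
  have \<sigma>: "?\<sigma> \<in> univ T" using as by (simp add: in_univ_T)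
  then have "Sigma_rel tree_vocabulary T \<alpha> 1 (orbit tree_vocabulary T [?\<sigma>])"
    using assms(1)[rule_format, of "[?\<sigma>]"] by (simp add: Sigma_definable_iff)
  then have "Sigma_rel V A \<alpha> (shape_size ?s)
      {bs \<in> tuples A (shape_size ?s). assemble ?s bs \<in> orbit tree_vocabulary T [?\<sigma>]}"
    by (rule Sigma_rel_assemble) simp
  moreover have "{bs \<in> tuples A (shape_size ?s). assemble ?s bs \<in> orbit tree_vocabulary T [?\<sigma>]} = orbit V A as"
  proof -
    have "assemble ?s bs \<in> orbit tree_vocabulary T [?\<sigma>] \<longleftrightarrow> bs \<in> orbit V A as" if "bs \<in> tuples A ?n" for bs
    proof -
      have "assemble ?s bs = [zip bs (replicate ?n 0)]" using that by (simp add: tuples_def)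
      moreover have "zip bs (replicate ?n 0) \<in> univ T" using that by (simp add: in_univ_T tuples_def)
      ultimately show ?thesis using orbit_node_iff[OF \<sigma>] that by (simp add: tuples_def)
    qed
    moreover have "orbit V A as \<subseteq> tuples A ?n" using as by (intro orbit_subset) (simp add: tuples_def)
    ultimately show ?thesis by (auto simp: shape_size_def)
  qed
  ultimately show ?thesis by (simp add: Sigma_definable_iff shape_size_def)
qed

end

section \<open>From the structure to the tree\<close>

primrec ancestor_tm :: "nat \<Rightarrow> nat \<Rightarrow> tree_fun tm"
where
  "ancestor_tm 0 i = Var i"
| "ancestor_tm (Suc j) i = App Parent [ancestor_tm j i]"

lemma tm_vars_ancestor: "tm_vars (ancestor_tm j i) = {i}"
  by (induction j) auto

lemma tm_in_ancestor: "tm_in tree_vocabulary (ancestor_tm j i)"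
  by (induction j) (auto simp: tree_vocabulary_def)

lemma tm_val_ancestor: "tm_val (tree_of_tuples e A) v (ancestor_tm j i) = take (length (v i) - j) (v i)"
  by (induction j)
    (auto simp: tree_of_tuples_def replicated_tree_def labelled_tree_def butlast_take)

context tuple_tree
begin

section \<open>Quantifier-free conditions on nodes\<close>

lemma qf_definable_ancestor_eq:
  assumes "i < m" "i' < m"
  shows "qf_definable tree_vocabulary T m
    (\<lambda>\<sigma>s. take (length (\<sigma>s ! i) - j) (\<sigma>s ! i) = take (length (\<sigma>s ! i') - j') (\<sigma>s ! i'))"
proof -
  have "qf_definable tree_vocabulary T m (\<lambda>\<sigma>s. atom_sat T (\<lambda>x. \<sigma>s ! x) (Eq (ancestor_tm j i) (ancestor_tm j' i')))"
    using assms by (intro qf_definable_atom) (auto simp: tm_vars_ancestor tm_in_ancestor)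
  then show ?thesis by (simp add: tm_val_ancestor)
qed

lemma qf_definable_prefix:
  assumes "i < m" "j < m"
  shows "qf_definable tree_vocabulary T m (\<lambda>\<sigma>s. prefix (\<sigma>s ! i) (\<sigma>s ! j))"
proof -
  have "qf_definable tree_vocabulary T m (\<lambda>\<sigma>s. atom_sat T (\<lambda>x. \<sigma>s ! x) (Rel Below [Var i, Var j]))"
    using assms by (intro qf_definable_atom) (auto simp: tree_vocabulary_def)
  then show ?thesis by (simp add: rel_int_tree)
qed

text \<open>There are finitely many bit lists of length \<open>N\<close>, so an arbitrary condition
  \<open>D\<close> on the diagram is a finite disjunction of label predicates.\<close>

lemma qf_definable_diagram:
  assumes "i < m"
  shows "qf_definable tree_vocabulary T m
    (\<lambda>\<sigma>s. length (\<sigma>s ! i) = N \<and> D (finite_diagram e A (map fst (\<sigma>s ! i))))"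
proof -
  let ?L = "{d :: bool list. length d = N \<and> D d}"
  have "finite ?L"
    by (rule finite_subset[OF _ finite_lists_length_eq[of "UNIV :: bool set" N]]) auto
  moreover have "qf_definable tree_vocabulary T m (\<lambda>\<sigma>s. tuple_label e A (map fst (\<sigma>s ! i)) = c)" for c
  proof -
    have "qf_definable tree_vocabulary T m (\<lambda>\<sigma>s. atom_sat T (\<lambda>x. \<sigma>s ! x) (Rel (Label c) [Var i]))"
      using assms by (intro qf_definable_atom) (auto simp: tree_vocabulary_def)
    then show ?thesis by (simp add: rel_int_tree)
  qed
  ultimately have "qf_definable tree_vocabulary T m
      (\<lambda>\<sigma>s. \<exists>d\<in>?L. tuple_label e A (map fst (\<sigma>s ! i)) = to_nat (N, d))"
    by (rule qf_definable_Bex)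
  then show ?thesis
    by (rule qf_definable_cong) (auto simp: tuple_label_def length_finite_diagram)
qed

lemma qf_definable_length:
  assumes "i < m"
  shows "qf_definable tree_vocabulary T m (\<lambda>\<sigma>s. length (\<sigma>s ! i) = N)"
  using qf_definable_diagram[OF assms, of N "\<lambda>_. True"] by simp

text \<open>A quantifier-free formula has finitely many atoms, and the diagram of a tuple longer
  than all their indices in \<open>e\<close> records each of them.\<close>

lemma finite_diagram_determines_qf:
  assumes "qf_in V p"
  shows "\<exists>N\<^sub>0. \<forall>as bs. length as = length bs \<and> N\<^sub>0 \<le> length as \<and> qf_vars p \<subseteq> {..<length as} \<and>
    finite_diagram e A as = finite_diagram e A bs \<longrightarrow> qf_sat A ((!) as) p = qf_sat A ((!) bs) p"
    (is "\<exists>N\<^sub>0. ?determined p N\<^sub>0")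
  using assms
proof (induction p)
  case (Atom a)
  then obtain j where j: "e j = a" using atom_in_enum by auto
  have "?determined (Atom a) (Suc j)"
  proof (intro allI impI)
    fix as bs
    assume "length as = length bs \<and> Suc j \<le> length as \<and> qf_vars (Atom a) \<subseteq> {..<length as} \<and>
      finite_diagram e A as = finite_diagram e A bs"
    then show "qf_sat A ((!) as) (Atom a) = qf_sat A ((!) bs) (Atom a)"
      using finite_diagram_nth[of j as e A] finite_diagram_nth[of j bs e A] j by auto
  qed
  then show ?case by (rule exI)
next
  case (Neg p)
  then obtain M where M: "?determined p M" by auto
  have "?determined (Neg p) M"
    unfolding qf_sat.simps qf_vars.simps using M by blast
  then show ?case by (rule exI)
next
  case (And p q)
  then obtain M N where M: "?determined p M" and N: "?determined q N" by auto
  have "?determined (And p q) (max M N)"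
    unfolding qf_sat.simps qf_vars.simps max.bounded_iff Un_subset_iff using M N by blast
  then show ?case by (rule exI)
next
  case (Or p q)
  then obtain M N where M: "?determined p M" and N: "?determined q N" by auto
  have "?determined (Or p q) (max M N)"
    unfolding qf_sat.simps qf_vars.simps max.bounded_iff Un_subset_iff using M N by blast
  then show ?case by (rule exI)
qed simp

text \<open>A quantifier-free condition on a tuple is not visible in the label of its node, but it is in the
  labels of all sufficiently long extensions of that node.\<close>

lemma qf_definable_extension:
  assumes "qf_definable V A n P"
  obtains N where "n \<le> N" "\<And>i m. i < m \<Longrightarrow> qf_definable tree_vocabulary T m
    (\<lambda>\<sigma>s. length (\<sigma>s ! i) = N \<and> P (take n (map fst (\<sigma>s ! i))))"
proof -
  obtain p where p: "qf_in V p" "qf_vars p \<subseteq> {..<n}" "\<forall>as\<in>tuples A n. qf_sat A ((!) as) p \<longleftrightarrow> P as"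
    using assms unfolding qf_definable_def by blast
  obtain N\<^sub>0 where N\<^sub>0: "\<And>as bs. length as = length bs \<Longrightarrow> N\<^sub>0 \<le> length as \<Longrightarrow> qf_vars p \<subseteq> {..<length as} \<Longrightarrow>
      finite_diagram e A as = finite_diagram e A bs \<Longrightarrow> qf_sat A ((!) as) p = qf_sat A ((!) bs) p"
    using finite_diagram_determines_qf[OF p(1)] by blast
  define N where "N = max n N\<^sub>0"
  have nN: "n \<le> N" by (simp add: N_def)
  \<comment> \<open>\<open>D\<close> accepts a diagram if some list having it satisfies
    \<open>p\<close>; at length \<open>N\<close> the diagram determines \<open>p\<close>, so the
    choice of the list is immaterial.\<close>
  define D where "D = (\<lambda>d. \<exists>as. length as = N \<and> finite_diagram e A as = d \<and> qf_sat A ((!) as) p)"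
  have D: "D (finite_diagram e A as) \<longleftrightarrow> P (take n as)" if as: "as \<in> tuples A N" for as
  proof -
    have len: "length as = N" using as by (simp add: tuples_def)
    have vars: "qf_vars p \<subseteq> {..<N}" using p(2) nN by auto
    have "D (finite_diagram e A as) \<longleftrightarrow> qf_sat A ((!) as) p"
    proof
      assume "D (finite_diagram e A as)"
      then obtain bs where bs: "length bs = N" "finite_diagram e A bs = finite_diagram e A as" "qf_sat A ((!) bs) p"
        unfolding D_def by blast
      moreover have "N\<^sub>0 \<le> N" by (simp add: N_def)
      ultimately show "qf_sat A ((!) as) p" using N\<^sub>0[of bs as] len vars by simp
    next
      assume "qf_sat A ((!) as) p"
      then show "D (finite_diagram e A as)" unfolding D_def using len by blast
    qed
    also have "\<dots> \<longleftrightarrow> qf_sat A ((!) (take n as)) p"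
      using p(2) by (intro qf_sat_cong) auto
    also have "\<dots> \<longleftrightarrow> P (take n as)"
    proof -
      have "take n as \<in> tuples A n"
        using as nN by (auto simp: tuples_def dest: in_set_takeD)
      then show ?thesis using p(3) by blast
    qed
    finally show ?thesis .
  qed
  show ?thesis
  proof (rule that[of N])
    show "n \<le> N" by (rule nN)
    fix i m :: nat assume i: "i < m"
    show "qf_definable tree_vocabulary T m
      (\<lambda>\<sigma>s. length (\<sigma>s ! i) = N \<and> P (take n (map fst (\<sigma>s ! i))))"
    proof (rule qf_definable_cong[OF qf_definable_diagram[OF i, of N D]])
      fix \<sigma>s assume "\<sigma>s \<in> tuples T m"
      then have "\<sigma>s ! i \<in> univ T" using i by (auto simp: tuples_def in_lists_conv_set)
      then have "map fst (\<sigma>s ! i) \<in> tuples A N" if "length (\<sigma>s ! i) = N"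
        using that unfolding in_univ_T tuples_def by simp
      then show "(length (\<sigma>s ! i) = N \<and> D (finite_diagram e A (map fst (\<sigma>s ! i)))) =
          (length (\<sigma>s ! i) = N \<and> P (take n (map fst (\<sigma>s ! i))))"
        using D by blast
    qed
  qed
qed

text \<open>At a positive level a node quantifier is at hand, and one extension plays two parts: it
  carries the witnesses \<open>bs\<close>, and it may be longer than they require so that its label
  shows a quantifier-free matrix. Hence no level is lost, even at
  \<open>\<alpha> = 1\<close>.\<close>

lemma Sigma_rel_nodes:
  assumes "Sigma_rel V A \<alpha> n S" "0 < \<alpha>"
  shows "Sigma_rel tree_vocabulary T \<alpha> 1 {\<sigma>s \<in> tuples T 1. map fst (\<sigma>s ! 0) \<in> S}"
  using assms
proof (induction rule: Sigma_rel.induct)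
  case (Sigma_rel_0 n P)
  then show ?case by simp
next
  case (Sigma_rel_step \<alpha> n k R)
  \<comment> \<open>A condition on a node and an extension of it; for each \<open>i\<close> a length
    \<open>N\<close> and a lower-level relation complementary to this condition are chosen
    together.\<close>
  let ?E = "\<lambda>i N \<sigma>s. length (\<sigma>s ! 0) = n \<and> prefix (\<sigma>s ! 0) (\<sigma>s ! 1) \<and> length (\<sigma>s ! 1) = N \<and>
      take (n + k i) (map fst (\<sigma>s ! 1)) \<notin> R i"
  have "\<forall>i. \<exists>x. n + k i \<le> fst x \<and> (\<exists>\<beta><\<alpha>. Sigma_rel tree_vocabulary T \<beta> 2 (snd x)) \<and>
      (\<forall>\<sigma>s\<in>tuples T 2. \<sigma>s \<notin> snd x \<longleftrightarrow> ?E i (fst x) \<sigma>s)"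
  proof
    fix i
    obtain \<beta> where \<beta>: "\<beta> < \<alpha>" "Sigma_rel V A \<beta> (n + k i) (R i)"
      "0 < \<beta> \<Longrightarrow> Sigma_rel tree_vocabulary T \<beta> 1 {\<sigma>s \<in> tuples T 1. map fst (\<sigma>s ! 0) \<in> R i}"
      using Sigma_rel_step.IH[of i] by blast
    show "\<exists>x. n + k i \<le> fst x \<and> (\<exists>\<beta><\<alpha>. Sigma_rel tree_vocabulary T \<beta> 2 (snd x)) \<and>
      (\<forall>\<sigma>s\<in>tuples T 2. \<sigma>s \<notin> snd x \<longleftrightarrow> ?E i (fst x) \<sigma>s)"
    proof (cases "\<beta> = 0")
      case True
      \<comment> \<open>A quantifier-free matrix: the extension gets a length \<open>N\<close>,
        possibly above \<open>n + k i\<close>, at which labels decide it.\<close>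
      have "qf_definable V A (n + k i) (\<lambda>as. as \<notin> R i)"
        using \<beta>(2) True by (intro qf_definable_not Sigma_rel_zeroD) simp
      then obtain N where N: "n + k i \<le> N" "\<And>j m. j < m \<Longrightarrow> qf_definable tree_vocabulary T m
          (\<lambda>\<sigma>s. length (\<sigma>s ! j) = N \<and> take (n + k i) (map fst (\<sigma>s ! j)) \<notin> R i)"
        by (rule qf_definable_extension) blast
      have "Sigma_rel tree_vocabulary T 0 2 {\<sigma>s \<in> tuples T 2. \<not> ?E i N \<sigma>s}"
        by (intro Sigma_rel.Sigma_rel_0 qf_definable_not qf_definable_and[OF qf_definable_length]
            qf_definable_and[OF qf_definable_prefix] N(2)) simp_all
      then show ?thesis
        using N(1) \<beta>(1) True by (intro exI[of _ "(N, {\<sigma>s \<in> tuples T 2. \<not> ?E i N \<sigma>s})"]) auto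
    next
      case False
      \<comment> \<open>A matrix of positive level: the induction hypothesis applies to the
        extension itself, so the exact length suffices.\<close>
      let ?N = "n + k i"
      let ?C = "\<lambda>\<sigma>s. length (\<sigma>s ! 0) = n \<and> prefix (\<sigma>s ! 0) (\<sigma>s ! 1) \<and> length (\<sigma>s ! 1) = ?N"
      let ?Q\<^sub>1 = "{\<sigma>s \<in> tuples T 2. \<not> ?C \<sigma>s}"
      let ?Q\<^sub>2 = "{\<sigma>s \<in> tuples T 2. map ((!) \<sigma>s) [1] \<in> {\<sigma>s \<in> tuples T 1. map fst (\<sigma>s ! 0) \<in> R i}}"
      have "0 < \<beta>" using False by (simp add: less_le)
      then have "Sigma_rel tree_vocabulary T \<beta> 2 ?Q\<^sub>2"
        by (intro Sigma_rel_reindex[OF \<beta>(3)]) simp_all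
      moreover have "Sigma_rel tree_vocabulary T 0 2 ?Q\<^sub>1"
        by (intro Sigma_rel.Sigma_rel_0 qf_definable_not qf_definable_and[OF qf_definable_length]
            qf_definable_and[OF qf_definable_prefix] qf_definable_length) simp_all
      ultimately have "Sigma_rel tree_vocabulary T \<beta> 2 (?Q\<^sub>1 \<union> ?Q\<^sub>2)"
        using Sigma_rel_mono[OF _ omega1_zero_le] by (intro Sigma_rel_union)
      moreover have "\<sigma>s \<notin> ?Q\<^sub>1 \<union> ?Q\<^sub>2 \<longleftrightarrow> ?E i ?N \<sigma>s" if "\<sigma>s \<in> tuples T 2" for \<sigma>s
      proof -
        have "\<sigma>s ! 1 \<in> univ T" using that by (auto simp: tuples_def in_lists_conv_set)
        then show ?thesis using that by (auto simp: tuples_def)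
      qed
      ultimately show ?thesis
        using \<beta>(1) by (intro exI[of _ "(?N, ?Q\<^sub>1 \<union> ?Q\<^sub>2)"]) auto
    qed
  qed
  from choice[OF this] obtain x where x: "\<forall>i. n + k i \<le> fst (x i) \<and>
      (\<exists>\<beta><\<alpha>. Sigma_rel tree_vocabulary T \<beta> 2 (snd (x i))) \<and>
      (\<forall>\<sigma>s\<in>tuples T 2. \<sigma>s \<notin> snd (x i) \<longleftrightarrow> ?E i (fst (x i)) \<sigma>s)" ..
  have x1: "n + k i \<le> fst (x i)" for i using x by blast
  have x2: "\<exists>\<beta><\<alpha>. Sigma_rel tree_vocabulary T \<beta> (1 + 1) (snd (x i))" for i
    unfolding one_add_one using x by blast
  have x3: "\<sigma>s \<notin> snd (x i) \<longleftrightarrow> ?E i (fst (x i)) \<sigma>s" if "\<sigma>s \<in> tuples T 2" for \<sigma>s i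
    using x[rule_format, of i, THEN conjunct2, THEN conjunct2] that by (rule bspec)
  have "Sigma_rel tree_vocabulary T \<alpha> 1 {\<sigma>s \<in> tuples T 1. \<exists>i. \<exists>\<tau>s\<in>tuples T 1. \<sigma>s @ \<tau>s \<notin> snd (x i)}"
    using \<open>0 < \<alpha>\<close> x2 by (rule Sigma_rel.Sigma_rel_step)
  moreover have "{\<sigma>s \<in> tuples T 1. \<exists>i. \<exists>\<tau>s\<in>tuples T 1. \<sigma>s @ \<tau>s \<notin> snd (x i)} =
      {\<sigma>s \<in> tuples T 1. map fst (\<sigma>s ! 0) \<in> {as \<in> tuples A n. \<exists>i. \<exists>bs\<in>tuples A (k i). as @ bs \<notin> R i}}"
  proof -
    have "(\<exists>\<tau>s\<in>tuples T 1. [\<sigma>] @ \<tau>s \<notin> snd (x i)) \<longleftrightarrow>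
        map fst \<sigma> \<in> tuples A n \<and> (\<exists>bs\<in>tuples A (k i). map fst \<sigma> @ bs \<notin> R i)" (is "?L \<longleftrightarrow> ?R")
      if \<sigma>: "\<sigma> \<in> univ T" for \<sigma> i
    proof
      assume ?L
      then obtain \<tau> where \<tau>: "\<tau> \<in> univ T" "[\<sigma>, \<tau>] \<notin> snd (x i)"
        by (auto simp: tuples_def length_Suc_conv)
      then have E: "length \<sigma> = n" "prefix \<sigma> \<tau>" "length \<tau> = fst (x i)" "take (n + k i) (map fst \<tau>) \<notin> R i"
        using x3[of "[\<sigma>, \<tau>]" i] \<sigma> by (simp_all add: tuples_def)
      obtain \<upsilon> where \<upsilon>: "\<tau> = \<sigma> @ \<upsilon>" using E(2) by (auto simp: prefix_def)
      have "take (n + k i) (map fst \<tau>) = map fst \<sigma> @ take (k i) (map fst \<upsilon>)"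
        using \<upsilon> E(1) by simp
      moreover have "take (k i) (map fst \<upsilon>) \<in> tuples A (k i)"
      proof -
        have "map fst \<upsilon> \<in> lists (univ A)" using \<tau>(1) \<upsilon> by (simp add: in_univ_T)
        moreover have "k i \<le> length \<upsilon>" using x1[of i] E(1,3) \<upsilon> by simp
        ultimately show ?thesis unfolding tuples_def by (auto dest: in_set_takeD)
      qed
      moreover have "map fst \<sigma> \<in> tuples A n" using \<sigma> E(1) unfolding in_univ_T tuples_def by simp
      ultimately show ?R using E(4) by auto
    next
      assume ?R
      then obtain bs where bs: "bs \<in> tuples A (k i)" "map fst \<sigma> @ bs \<notin> R i" and len: "length \<sigma> = n"
        by (auto simp: tuples_def)
      obtain a\<^sub>0 where a\<^sub>0: "a\<^sub>0 \<in> univ A" using model by (auto simp: is_model_def)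
      \<comment> \<open>The witnesses are padded with an arbitrary \<open>a\<^sub>0\<close> to the
        prescribed length; \<open>?E\<close> tests only the first \<open>n + k i\<close> entries
        against \<open>R i\<close>.\<close>
      define \<tau> where "\<tau> = \<sigma> @ map (\<lambda>a. (a, 0)) (bs @ replicate (fst (x i) - (n + k i)) a\<^sub>0)"
      have map_\<tau>: "map fst \<tau> = map fst \<sigma> @ bs @ replicate (fst (x i) - (n + k i)) a\<^sub>0"
        by (simp add: \<tau>_def o_def)
      have "\<tau> \<in> univ T"
        unfolding in_univ_T map_\<tau> using \<sigma>[unfolded in_univ_T] bs(1) a\<^sub>0
        by (auto simp: tuples_def in_lists_conv_set)
      moreover have "length \<tau> = fst (x i)"
        using arg_cong[OF map_\<tau>, of length] len bs(1) x1[of i] by (simp add: tuples_def)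
      moreover have "take (n + k i) (map fst \<tau>) = map fst \<sigma> @ bs"
        unfolding map_\<tau> using len bs(1) by (simp add: tuples_def)
      moreover have "prefix \<sigma> \<tau>" by (simp add: \<tau>_def)
      ultimately have "[\<sigma>] @ [\<tau>] \<notin> snd (x i)" "[\<tau>] \<in> tuples T 1"
        using x3[of "[\<sigma>, \<tau>]" i] \<sigma> len bs(2) by (simp_all add: tuples_def)
      then show ?L by blast
    qed
    moreover have "\<exists>\<sigma>. \<sigma>s = [\<sigma>] \<and> \<sigma> \<in> univ T" if "\<sigma>s \<in> tuples T 1" for \<sigma>s
      using that by (auto simp: tuples_def length_Suc_conv)
    ultimately show ?thesis by fastforce
  qed
  ultimately show ?case by (simp only:)
qed

section \<open>Definability of orbits in the tree\<close>

lemma tree_sim_zip_iff: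
  assumes "length \<sigma>s = m" "length \<sigma>s' = m" "\<sigma>s \<in> lists (univ T)" "\<sigma>s' \<in> lists (univ T)"
  shows "tree_sim (set (zip \<sigma>s \<sigma>s')) \<longleftrightarrow>
    (\<forall>i<m. map fst (\<sigma>s' ! i) \<in> orbit V A (map fst (\<sigma>s ! i))) \<and>
    (\<forall>i<m. \<forall>j<m. \<forall>k. k \<le> length (\<sigma>s ! i) \<longrightarrow> k \<le> length (\<sigma>s ! j) \<longrightarrow>
      (take k (\<sigma>s ! i) = take k (\<sigma>s ! j) \<longleftrightarrow> take k (\<sigma>s' ! i) = take k (\<sigma>s' ! j)))"
  (is "_ \<longleftrightarrow> ?orbits \<and> ?shape")
proof
  assume sim: "tree_sim (set (zip \<sigma>s \<sigma>s'))"
  have mem: "(\<sigma>s ! i, \<sigma>s' ! i) \<in> set (zip \<sigma>s \<sigma>s')" if "i < m" for i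
    using that assms(1,2) by (auto simp: in_set_zip)
  have ?orbits using tree_simD(3)[OF sim mem] by simp
  moreover have ?shape using tree_sim_take[OF sim mem mem] by simp
  ultimately show "?orbits \<and> ?shape" by (rule conjI)
next
  assume R: "?orbits \<and> ?shape"
  have mem: "\<exists>i<m. \<sigma> = \<sigma>s ! i \<and> \<sigma>' = \<sigma>s' ! i" if "(\<sigma>, \<sigma>') \<in> set (zip \<sigma>s \<sigma>s')" for \<sigma> \<sigma>'
    using that assms(1,2) by (auto simp: in_set_zip)
  show "tree_sim (set (zip \<sigma>s \<sigma>s'))"
    unfolding tree_sim_def
  proof (intro conjI allI impI)
    fix \<sigma> \<sigma>' assume *: "(\<sigma>, \<sigma>') \<in> set (zip \<sigma>s \<sigma>s')"
    show "\<sigma> \<in> univ T" using set_zip_leftD[OF *] assms(3) by (simp add: in_lists_conv_set)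
    show "\<sigma>' \<in> univ T" using set_zip_rightD[OF *] assms(4) by (simp add: in_lists_conv_set)
    show "map fst \<sigma>' \<in> orbit V A (map fst \<sigma>)" using mem[OF *] R by auto
  next
    fix \<sigma> \<sigma>' \<tau> \<tau>' k
    assume *: "(\<sigma>, \<sigma>') \<in> set (zip \<sigma>s \<sigma>s')" "(\<tau>, \<tau>') \<in> set (zip \<sigma>s \<sigma>s')" "k \<le> length \<sigma>" "k \<le> length \<tau>"
    obtain i j where "i < m" "\<sigma> = \<sigma>s ! i" "\<sigma>' = \<sigma>s' ! i" "j < m" "\<tau> = \<sigma>s ! j" "\<tau>' = \<sigma>s' ! j"
      using mem[OF *(1)] mem[OF *(2)] by auto
    then show "take k \<sigma> = take k \<tau> \<longleftrightarrow> take k \<sigma>' = take k \<tau>'"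
      using R[THEN conjunct2, rule_format, of i j k] *(3,4) by simp
  qed
qed

lemma Sigma_definable_orbit_in_tree:
  assumes "\<forall>as\<in>lists (univ A). Sigma_definable V A \<alpha> (length as) (orbit V A as)" "0 < \<alpha>"
    and \<sigma>s: "\<sigma>s \<in> lists (univ T)"
  shows "Sigma_definable tree_vocabulary T \<alpha> (length \<sigma>s) (orbit tree_vocabulary T \<sigma>s)"
proof -
  let ?m = "length \<sigma>s"
  let ?O = "\<lambda>i. {\<tau>s \<in> tuples T ?m. map ((!) \<tau>s) [i] \<in> {\<tau>s \<in> tuples T 1. map fst (\<tau>s ! 0) \<in> orbit V A (map fst (\<sigma>s ! i))}}"
  \<comment> \<open>Terms count upwards from a node, so height \<open>k\<close> is reached in
    \<open>length (\<sigma>s ! i) - k\<close> steps; in \<open>\<tau>s ! i\<close> these steps end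
    at height \<open>k\<close> as soon as the lengths agree.\<close>
  let ?a = "\<lambda>\<tau>s i k. take (length (\<tau>s ! i) - (length (\<sigma>s ! i) - k)) (\<tau>s ! i)"
  let ?Q = "\<lambda>\<tau>s. \<forall>i\<in>{..<?m}. \<forall>j\<in>{..<?m}. \<forall>k\<in>{..min (length (\<sigma>s ! i)) (length (\<sigma>s ! j))}.
    take k (\<sigma>s ! i) = take k (\<sigma>s ! j) \<longleftrightarrow> ?a \<tau>s i k = ?a \<tau>s j k"
  have univ: "\<sigma>s ! i \<in> univ T" if "i < ?m" for i using \<sigma>s that by (auto simp: in_lists_conv_set)
  have "Sigma_rel tree_vocabulary T \<alpha> ?m (?O i)" if i: "i < ?m" for i
  proof (rule Sigma_rel_reindex)
    have "Sigma_rel V A \<alpha> (length (\<sigma>s ! i)) (orbit V A (map fst (\<sigma>s ! i)))"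
      using assms(1)[rule_format, of "map fst (\<sigma>s ! i)"] univ[OF i, unfolded in_univ_T]
      by (simp add: Sigma_definable_iff)
    then show "Sigma_rel tree_vocabulary T \<alpha> 1 {\<tau>s \<in> tuples T 1. map fst (\<tau>s ! 0) \<in> orbit V A (map fst (\<sigma>s ! i))}"
      using assms(2) by (rule Sigma_rel_nodes)
  qed (use i in simp_all)
  then have "Sigma_rel tree_vocabulary T \<alpha> ?m {\<tau>s \<in> tuples T ?m. \<forall>i\<in>{..<?m}. \<tau>s \<in> ?O i}"
    by (intro Sigma_rel_INT) simp_all
  moreover have "Sigma_rel tree_vocabulary T 0 ?m {\<tau>s \<in> tuples T ?m. ?Q \<tau>s}"
    by (intro Sigma_rel_0 qf_definable_Ball qf_definable_iff qf_definable_const qf_definable_ancestor_eq)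
      simp_all
  ultimately have "Sigma_rel tree_vocabulary T \<alpha> ?m
      ({\<tau>s \<in> tuples T ?m. \<forall>i\<in>{..<?m}. \<tau>s \<in> ?O i} \<inter> {\<tau>s \<in> tuples T ?m. ?Q \<tau>s})"
    using Sigma_rel_mono[OF _ omega1_zero_le] by (intro Sigma_rel_inter)
  moreover have "{\<tau>s \<in> tuples T ?m. \<forall>i\<in>{..<?m}. \<tau>s \<in> ?O i} \<inter> {\<tau>s \<in> tuples T ?m. ?Q \<tau>s} =
      orbit tree_vocabulary T \<sigma>s"
  proof -
    have "(\<forall>i\<in>{..<?m}. \<tau>s \<in> ?O i) \<and> ?Q \<tau>s \<longleftrightarrow> \<tau>s \<in> orbit tree_vocabulary T \<sigma>s"
      if \<tau>s: "\<tau>s \<in> tuples T ?m" for \<tau>s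
    proof -
      have \<tau>s_univ: "\<tau>s ! i \<in> univ T" if "i < ?m" for i
        using \<tau>s that by (auto simp: tuples_def in_lists_conv_set)
      have O: "\<tau>s \<in> ?O i \<longleftrightarrow> map fst (\<tau>s ! i) \<in> orbit V A (map fst (\<sigma>s ! i))" if "i < ?m" for i
        using \<tau>s \<tau>s_univ[OF that] by (simp add: tuples_def)
      \<comment> \<open>Asserted only under the orbit conditions, which force equal lengths.\<close>
      have Q: "?Q \<tau>s \<longleftrightarrow> (\<forall>i<?m. \<forall>j<?m. \<forall>k. k \<le> length (\<sigma>s ! i) \<longrightarrow> k \<le> length (\<sigma>s ! j) \<longrightarrow>
          (take k (\<sigma>s ! i) = take k (\<sigma>s ! j) \<longleftrightarrow> take k (\<tau>s ! i) = take k (\<tau>s ! j)))"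
        if orb: "\<forall>i<?m. map fst (\<tau>s ! i) \<in> orbit V A (map fst (\<sigma>s ! i))"
      proof -
        have "length (\<tau>s ! i) = length (\<sigma>s ! i)" if "i < ?m" for i
          using orbit_length[OF orb[rule_format, OF that]] by simp
        then have "?a \<tau>s i k = take k (\<tau>s ! i)" if "i < ?m" "k \<le> length (\<sigma>s ! i)" for i k
          using that by simp
        then show ?thesis by (auto simp: Ball_def)
      qed
      have "\<tau>s \<in> orbit tree_vocabulary T \<sigma>s \<longleftrightarrow> tree_sim (set (zip \<sigma>s \<tau>s))"
        using orbit_tree_iff[of \<sigma>s ?m \<tau>s] \<sigma>s \<tau>s by (simp add: tuples_def)
      also have "\<dots> \<longleftrightarrow> (\<forall>i<?m. map fst (\<tau>s ! i) \<in> orbit V A (map fst (\<sigma>s ! i))) \<and>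
          (\<forall>i<?m. \<forall>j<?m. \<forall>k. k \<le> length (\<sigma>s ! i) \<longrightarrow> k \<le> length (\<sigma>s ! j) \<longrightarrow>
          (take k (\<sigma>s ! i) = take k (\<sigma>s ! j) \<longleftrightarrow> take k (\<tau>s ! i) = take k (\<tau>s ! j)))"
        using \<tau>s \<sigma>s by (intro tree_sim_zip_iff) (simp_all add: tuples_def)
      also have "\<dots> \<longleftrightarrow> (\<forall>i<?m. map fst (\<tau>s ! i) \<in> orbit V A (map fst (\<sigma>s ! i))) \<and> ?Q \<tau>s"
        using Q by (rule conj_cong[OF refl, symmetric])
      also have "\<dots> \<longleftrightarrow> (\<forall>i\<in>{..<?m}. \<tau>s \<in> ?O i) \<and> ?Q \<tau>s"
        using O by blast
      finally show ?thesis by (rule sym)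
    qed
    moreover have "orbit tree_vocabulary T \<sigma>s \<subseteq> tuples T ?m"
      using \<sigma>s by (intro orbit_subset) (simp add: tuples_def)
    ultimately show ?thesis by blast
  qed
  ultimately show ?thesis by (simp only: Sigma_definable_iff)
qed

end

text \<open>Rank 0 is split off because a short label may hide an atom. Let A have two elements
  separated by a unary predicate, the only symbol, and let \<open>e\<close> start with
  \<open>x = x\<close>. Then A has rank 0, but the nodes of length 1 over the two elements carry
  equal labels and lie in different orbits, so the tree has rank 1.\<close>

theorem mainTheorem10:
  fixes V :: "('f, 'r) vocabulary" and A :: "('a, 'f, 'r) model"
    and e :: "nat \<Rightarrow> ('f, 'r) atom"
  assumes "countable_vocabulary V"
    and "is_model V A" and "countable (univ A)"
    and "enumerates_atoms V e"
  shows "(scott_rank V A \<noteq> 0 \<longrightarrow>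
            scott_rank V A = scott_rank tree_vocabulary (tree_of_tuples e A)) \<and>
         (scott_rank V A = 0 \<longrightarrow>
            scott_rank tree_vocabulary (tree_of_tuples e A) \<le> 1)"
proof -
  interpret tuple_tree V A e using assms(2-4) by unfold_locales
  define P where "P = (\<lambda>\<alpha>. \<forall>as\<in>lists (univ A). Sigma_definable V A \<alpha> (length as) (orbit V A as))"
  define Q where "Q = (\<lambda>\<alpha>. \<forall>\<sigma>s\<in>lists (univ T).
    Sigma_definable tree_vocabulary T \<alpha> (length \<sigma>s) (orbit tree_vocabulary T \<sigma>s))"
  have ranks: "scott_rank V A = Least P" "scott_rank tree_vocabulary T = Least Q"
    by (simp_all add: scott_rank_def P_def Q_def)
  have QP: "P \<alpha>" if "Q \<alpha>" for \<alpha>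
    using that Sigma_definable_orbit_of_tree unfolding P_def Q_def by blast
  have PQ: "Q \<alpha>" if "P \<alpha>" "0 < \<alpha>" for \<alpha>
    using that Sigma_definable_orbit_in_tree unfolding P_def Q_def by blast
  have P_mono: "P \<beta>" if "P \<alpha>" "\<alpha> \<le> \<beta>" for \<alpha> \<beta>
    using that Sigma_rel_mono unfolding P_def Sigma_definable_iff by blast
  show ?thesis
  proof (cases "P 0")
    case True
    \<comment> \<open>Definability in A is raised to level 1, where the transfer to the tree is
      available.\<close>
    then have "Q 1" using P_mono[of 0 1] PQ omega1_zero_less_one by simp
    then have "Least Q \<le> 1" by (rule Least_le)
    moreover have "Least P = 0" using True Least_le[of P 0] by (simp add: antisym)
    ultimately show ?thesis by (simp add: ranks)
  next
    case False
    \<comment> \<open>Level 0 is settled by \<open>QP\<close>: since \<open>P 0\<close> fails, so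
      does \<open>Q 0\<close>.\<close>
    have "P \<alpha> = Q \<alpha>" for \<alpha>
      using False QP[of \<alpha>] PQ[of \<alpha>] by (cases "\<alpha> = 0") (auto simp: less_le)
    then have "P = Q" by blast
    then have eq: "Least P = Least Q" by simp
    show ?thesis using eq omega1_zero_le by (simp add: ranks)
  qed
qed

end
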